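(* Let $\beta\in(0,1)$, $\eta>0$. Let $Y_f^{\beta,\eta}(t)=\sum_{i=1}^{N_f(t)}X_i$, $t\ge0$, where the iid jumps $X_i$ have the Mittag-Leffler distribution with parameters $\beta,\eta$, and let $Y_f^\eta(t)=\sum_{i=1}^{N_f(t)}X'_i$, $t\ge0$, where the iid jumps $X'_i$ are exponentially distributed with parameter $\eta$. Let $\{D_\beta(t)\}_{t\ge0}$ be a $\beta$-stable subordinator independent of $\{Y_f^\eta(t)\}_{t\ge0}$. Then $$Y_f^{\beta,\eta}(t)\stackrel{d}{=}D_\beta\big(Y_f^\eta(t)\big),\qquad t\ge0.$$
   Context: Let $f(s)=bs+\int_0^\infty(1-e^{-sx})\,\nu(dx)$, $s>0$, with $b\ge 0$ and $\nu$ a non-negative L\'evy measure on $(0,\infty)$ with $\int_0^\infty (x\wedge 1)\,\nu(dx)<\infty$ and $\nu((0,\infty))=\infty$. Let $\{D_f(t)\}_{t\ge0}$ be the L\'evy subordinator with $\mathbb{E}[e^{-sD_f(t)}]=e^{-tf(s)}$ and $E_f(t)=\inf\{r\ge0: D_f(r)>t\}$ its inverse. Let $\{N(t)\}_{t\ge0}$ be a Poisson process with rate $\lambda>0$ independent of $\{E_f(t)\}$, and $N_f(t)=N(E_f(t))$. In each process the jumps are independent of $N$ and $E_f$, and an empty sum is $0$. The Mittag-Leffler distribution with parameters $\beta\in(0,1]$, $\eta>0$ has density $\eta x^{\beta-1}E_{\beta,\beta}(-\eta x^\beta)$, $x>0$, where $E_{\beta,\beta}(z)=\sum_{n\ge0}z^n/\Gamma(\beta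 n+\beta)$; its Laplace transform is $\eta/(s^\beta+\eta)$. The $\beta$-stable subordinator satisfies $\mathbb{E}[e^{-sD_\beta(t)}]=e^{-ts^\beta}$. The symbol $\stackrel{d}{=}$ denotes equality in distribution for each $t$. *)

theory Defs
  imports "HOL-Probability.Probability"
begin

text \<open>
  Independence of two random elements. This is \<open>prob_space.indep_var\<close> except that the two
  value spaces may have different types.
\<close>

definition independent_elements ::
    "'a measure \<Rightarrow> 'b measure \<Rightarrow> ('a \<Rightarrow> 'b) \<Rightarrow> 'c measure \<Rightarrow> ('a \<Rightarrow> 'c) \<Rightarrow> bool" where
  "independent_elements M S U T V \<longleftrightarrow>
     U \<in> measurable M S \<and> V \<in> measurable M T \<and>
     prob_space.indep_set M
       (sets (vimage_algebra (space M) U S)) (sets (vimage_algebra (space M) V T))"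

text \<open>
  Processes are maps \<open>X t \<omega>\<close> with a real time parameter, of which only
  \<open>t \<ge> 0\<close> is meaningful. Independence of whole processes is independence of
  their paths, seen as random elements of the product space \<open>\<real>\<^bsup>[0,\<infinity>)\<^esup>\<close>.
\<close>

definition path_space :: "(real \<Rightarrow> real) measure" where
  "path_space = PiM {0..} (\<lambda>_. borel)"

definition path :: "(real \<Rightarrow> 'a \<Rightarrow> real) \<Rightarrow> 'a \<Rightarrow> real \<Rightarrow> real" where
  "path X \<omega> = (\<lambda>t\<in>{0..}. X t \<omega>)"

text \<open>
  Almost every path starts at 0, is nondecreasing and right-continuous; left limits then exist.
\<close>

definition increasing_cadlag_process :: "'a measure \<Rightarrow> (real \<Rightarrow> 'a \<Rightarrow> real) \<Rightarrow> bool" where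
  "increasing_cadlag_process M X \<longleftrightarrow>
     (\<forall>t\<ge>0. X t \<in> borel_measurable M) \<and>
     (AE \<omega> in M.
        X 0 \<omega> = 0 \<and>
        mono_on {0..} (\<lambda>t. X t \<omega>) \<and>
        (\<forall>t\<ge>0. continuous (at_right t) (\<lambda>s. X s \<omega>)))"

definition independent_increments :: "'a measure \<Rightarrow> (real \<Rightarrow> 'a \<Rightarrow> real) \<Rightarrow> bool" where
  "independent_increments M X \<longleftrightarrow>
     (\<forall>(n::nat) (t::nat \<Rightarrow> real). 0 \<le> t 0 \<and> (\<forall>i<n. t i \<le> t (Suc i)) \<longrightarrow>
        prob_space.indep_vars M (\<lambda>_. borel) (\<lambda>i \<omega>. X (t (Suc i)) \<omega> - X (t i) \<omega>) {..<n})"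

definition stationary_increments :: "'a measure \<Rightarrow> (real \<Rightarrow> 'a \<Rightarrow> real) \<Rightarrow> bool" where
  "stationary_increments M X \<longleftrightarrow>
     (\<forall>s\<ge>0. \<forall>h\<ge>0. distr M borel (\<lambda>\<omega>. X (s + h) \<omega> - X s \<omega>) = distr M borel (\<lambda>\<omega>. X h \<omega> - X 0 \<omega>))"

definition levy_subordinator ::
    "'a measure \<Rightarrow> (real \<Rightarrow> real) \<Rightarrow> (real \<Rightarrow> 'a \<Rightarrow> real) \<Rightarrow> bool" where
  "levy_subordinator M f D \<longleftrightarrow>
     increasing_cadlag_process M D \<and> independent_increments M D \<and> stationary_increments M D \<and>
     (\<forall>t\<ge>0. \<forall>s>0. (\<integral>\<omega>. exp (- s * D t \<omega>) \<partial>M) = exp (- t * f s))"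

definition stable_subordinator :: "'a measure \<Rightarrow> real \<Rightarrow> (real \<Rightarrow> 'a \<Rightarrow> real) \<Rightarrow> bool" where
  "stable_subordinator M \<beta> D \<longleftrightarrow> levy_subordinator M (\<lambda>s. s powr \<beta>) D"

text \<open>L\'evy measures on \<open>(0,\<infinity>)\<close> of subordinators, with infinite activity.\<close>

definition infinite_levy_measure :: "real measure \<Rightarrow> bool" where
  "infinite_levy_measure \<nu> \<longleftrightarrow>
     sets \<nu> = sets (restrict_space borel {0<..}) \<and>
     (\<integral>\<^sup>+x. ennreal (min x 1) \<partial>\<nu>) < \<infinity> \<and>
     emeasure \<nu> {0<..} = \<infinity>"

definition bernstein_fun :: "real \<Rightarrow> real measure \<Rightarrow> real \<Rightarrow> real" where
  "bernstein_fun b \<nu> s = b * s + (\<integral>x. (1 - exp (- s * x)) \<partial>\<nu>)"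

text \<open>
  If \<open>D\<close> has infinite activity, its paths tend to infinity almost surely, so that the set
  is nonempty outside a null event.
\<close>

definition inverse_subordinator :: "(real \<Rightarrow> 'a \<Rightarrow> real) \<Rightarrow> real \<Rightarrow> 'a \<Rightarrow> real" where
  "inverse_subordinator D t \<omega> = Inf {r. r \<ge> 0 \<and> D r \<omega> > t}"

definition poisson_process :: "'a measure \<Rightarrow> real \<Rightarrow> (real \<Rightarrow> 'a \<Rightarrow> nat) \<Rightarrow> bool" where
  "poisson_process M l N \<longleftrightarrow>
     increasing_cadlag_process M (\<lambda>t \<omega>. real (N t \<omega>)) \<and>
     independent_increments M (\<lambda>t \<omega>. real (N t \<omega>)) \<and>
     (\<forall>s\<ge>0. \<forall>t>s. distr M (count_space UNIV) (\<lambda>\<omega>. N t \<omega> - N s \<omega>)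
                    = measure_pmf (poisson_pmf (l * (t - s))))"

definition time_change :: "(real \<Rightarrow> 'a \<Rightarrow> 'b) \<Rightarrow> (real \<Rightarrow> 'a \<Rightarrow> real) \<Rightarrow> real \<Rightarrow> 'a \<Rightarrow> 'b" where
  "time_change X T t \<omega> = X (T t \<omega>) \<omega>"

definition compound_process ::
    "(real \<Rightarrow> 'a \<Rightarrow> nat) \<Rightarrow> (nat \<Rightarrow> 'a \<Rightarrow> real) \<Rightarrow> real \<Rightarrow> 'a \<Rightarrow> real" where
  "compound_process N X t \<omega> = (\<Sum>i=1..N t \<omega>. X i \<omega>)"

definition mittag_leffler :: "real \<Rightarrow> real \<Rightarrow> real \<Rightarrow> real" where
  "mittag_leffler \<alpha> \<beta> z = (\<Sum>n. z ^ n / Gamma (\<alpha> * real n + \<beta>))"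

definition mittag_leffler_density :: "real \<Rightarrow> real \<Rightarrow> real \<Rightarrow> real" where
  "mittag_leffler_density \<beta> \<eta> x =
     (if x > 0 then \<eta> * x powr (\<beta> - 1) * mittag_leffler \<beta> \<beta> (- \<eta> * x powr \<beta>) else 0)"

text \<open>Jumps are numbered from 1.\<close>

definition iid_jumps :: "'a measure \<Rightarrow> (real \<Rightarrow> real) \<Rightarrow> (nat \<Rightarrow> 'a \<Rightarrow> real) \<Rightarrow> bool" where
  "iid_jumps M g X \<longleftrightarrow>
     prob_space.indep_vars M (\<lambda>_. borel) X {1..} \<and>
     (\<forall>i\<ge>1. distributed M lborel (X i) (\<lambda>x. ennreal (g x)))"

text \<open>The jump sequence is independent of the pair of processes \<open>(N, E)\<close>.\<close>

definition jumps_independent_of ::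
    "'a measure \<Rightarrow> (nat \<Rightarrow> 'a \<Rightarrow> real) \<Rightarrow> (real \<Rightarrow> 'a \<Rightarrow> nat) \<Rightarrow> (real \<Rightarrow> 'a \<Rightarrow> real) \<Rightarrow> bool" where
  "jumps_independent_of M X N E \<longleftrightarrow>
     independent_elements M
       (PiM {1..} (\<lambda>_. borel)) (\<lambda>\<omega>. \<lambda>i\<in>{1..}. X i \<omega>)
       (path_space \<Otimes>\<^sub>M path_space) (\<lambda>\<omega>. (path (\<lambda>t \<omega>. real (N t \<omega>)) \<omega>, path E \<omega>))"

definition processes_independent ::
    "'a measure \<Rightarrow> (real \<Rightarrow> 'a \<Rightarrow> real) \<Rightarrow> (real \<Rightarrow> 'a \<Rightarrow> real) \<Rightarrow> bool" where
  "processes_independent M X Y \<longleftrightarrow>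
     independent_elements M path_space (path X) path_space (path Y)"

text \<open>
  Paths are regular only almost surely, so a time-changed process is a random variable only up
  to modification on a null event. Laws are therefore taken with respect to the completion of
  \<open>M\<close>, which makes no difference for random variables on \<open>M\<close> itself; see the lemma below.
\<close>

definition eq_in_distribution :: "'a measure \<Rightarrow> ('a \<Rightarrow> real) \<Rightarrow> ('a \<Rightarrow> real) \<Rightarrow> bool" where
  "eq_in_distribution M U V \<longleftrightarrow>
     U \<in> borel_measurable (completion M) \<and> V \<in> borel_measurable (completion M) \<and>
     distr (completion M) borel U = distr (completion M) borel V"

lemma eq_in_distribution_iff:
  assumes "U \<in> borel_measurable M" and "V \<in> borel_measurable M"
  shows "eq_in_distribution M U V \<longleftrightarrow> distr M borel U = distr M borel V"
  using assms by (simp add: eq_in_distribution_def distr_completion measurable_completion)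

lemma independent_elements_iff_indep_var:
  fixes U V :: "'a \<Rightarrow> 'b"
  assumes "prob_space M"
  shows "independent_elements M S U T V \<longleftrightarrow> prob_space.indep_var M S U T V"
proof -
  interpret prob_space M by fact
  have *: "sigma_sets (space M) {W -` A \<inter> space M |A. A \<in> sets R} =
      sets (vimage_algebra (space M) W R)" for W :: "'a \<Rightarrow> 'b" and R
    by (subst sets_vimage_algebra) simp
  show ?thesis
    by (simp add: independent_elements_def indep_var_eq * conj_assoc)
qed

end

theory Submission
  imports Defs
begin

text \<open>
  A nonnegative random variable is determined by its Laplace transform at the natural numbers
  (Weierstrass approximation after the substitution \<open>u = exp (- x)\<close>), so it suffices to compare
  Laplace transforms. Conditioning on \<open>K = N\<^sub>f t\<close>, the left-hand side has transform
  \<open>\<bbbE> (\<eta> / (\<eta> + s powr \<beta>)) ^ K\<close>. By independence the right-hand side has transform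
  \<open>\<bbbE> exp (- (s powr \<beta>) Y' t)\<close>, which is the same because the transform of an
  exponential jump at \<open>s powr \<beta>\<close> is \<open>\<eta> / (\<eta> + s powr \<beta>)\<close>. Independence of a
  process and its random time is exploited by approximating the time from above by a discrete grid.

  The Laplace transform of a Mittag-Leffler jump is obtained without analytic continuation: the
  \<open>\<beta>\<close>-stable subordinator at an independent exponential time has the transform
  \<open>\<eta> / (\<eta> + s powr \<beta>)\<close> for all \<open>s\<close>, and its law is identified with the Mittag-Leffler
  distribution by comparing transforms for large \<open>s\<close>.
\<close>

subsection \<open>Uniqueness of Laplace transforms\<close>

text \<open>Under z -> exp (- z) the hypothesis says that two finite signed measures on [0,1] have
  the same moments. Hence they agree on polynomials, and a uniform error \<open>e\<close> in
  Weierstrass approximation costs at most \<open>e\<close> times the combined total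
  variation.\<close>

lemma laplace_continuous_weight_eq:
  fixes Z1 W1 :: "'a \<Rightarrow> real" and Z2 W2 :: "'b \<Rightarrow> real" and u :: "real \<Rightarrow> real"
  assumes [measurable]: "Z1 \<in> borel_measurable P" "Z2 \<in> borel_measurable Q"
    and W1: "integrable P W1" and W2: "integrable Q W2"
    and Z1: "AE x in P. 0 \<le> Z1 x" and Z2: "AE x in Q. 0 \<le> Z2 x"
    and eq: "\<And>n::nat. (\<integral>x. exp (- real n * Z1 x) * W1 x \<partial>P) = (\<integral>x. exp (- real n * Z2 x) * W2 x \<partial>Q)"
    and u: "continuous_on {0..1} u" and [measurable]: "u \<in> borel_measurable borel"
  shows "(\<integral>x. u (exp (- Z1 x)) * W1 x \<partial>P) = (\<integral>x. u (exp (- Z2 x)) * W2 x \<partial>Q)"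
proof -
  have [measurable]: "W1 \<in> borel_measurable P" "W2 \<in> borel_measurable Q"
    using W1 W2 by auto
  obtain B where B: "\<And>x. x \<in> {0..1} \<Longrightarrow> \<bar>u x\<bar> \<le> B"
    using compact_imp_bounded[OF compact_continuous_image[OF u compact_Icc]]
    unfolding bounded_iff by (metis image_eqI real_norm_def)
  have int: "integrable R (\<lambda>x. v (exp (- Z x)) * W x)"
    if "integrable R W" "Z \<in> borel_measurable R" "AE x in R. 0 \<le> Z x"
      "v \<in> borel_measurable borel" "\<And>x. x \<in> {0..1} \<Longrightarrow> \<bar>v x\<bar> \<le> C"
    for R :: "'c measure" and Z W :: "'c \<Rightarrow> real" and v :: "real \<Rightarrow> real" and C
  proof (rule Bochner_Integration.integrable_bound)
    show "integrable R (\<lambda>x. C * W x)" using that by simp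
    have [measurable]: "Z \<in> borel_measurable R" "W \<in> borel_measurable R" "v \<in> borel_measurable borel"
      using that by auto
    show "(\<lambda>x. v (exp (- Z x)) * W x) \<in> borel_measurable R" by measurable
    show "AE x in R. norm (v (exp (- Z x)) * W x) \<le> norm (C * W x)"
      using that(3)
    proof eventually_elim
      case (elim x)
      with that(5)[of "exp (- Z x)"] have "\<bar>v (exp (- Z x))\<bar> \<le> \<bar>C\<bar>" by auto
      then show ?case by (auto simp: abs_mult intro!: mult_right_mono)
    qed
  qed
  let ?I = "\<lambda>v. (\<integral>x. v (exp (- Z1 x)) * W1 x \<partial>P)" and ?J = "\<lambda>v. (\<integral>x. v (exp (- Z2 x)) * W2 x \<partial>Q)"
  let ?K = "(\<integral>x. \<bar>W1 x\<bar> \<partial>P) + (\<integral>x. \<bar>W2 x\<bar> \<partial>Q)"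
  have close: "\<bar>?I u - ?J u\<bar> \<le> e * ?K" if "e > 0" for e
  proof -
    obtain g where g: "real_polynomial_function g" "\<And>x. x \<in> {0..1} \<Longrightarrow> \<bar>u x - g x\<bar> < e"
      using Stone_Weierstrass_real_polynomial_function[OF compact_Icc u \<open>e > 0\<close>] by metis
    obtain a n where g_eq: "g = (\<lambda>x. \<Sum>i\<le>n. a i * x ^ i)"
      using g(1) by (auto simp: real_polynomial_function_iff_sum)
    have [measurable]: "g \<in> borel_measurable borel"
      unfolding g_eq by measurable
    have power: "integrable R (\<lambda>x. exp (- Z x) ^ i * W x)"
      if "integrable R W" "Z \<in> borel_measurable R" "AE x in R. 0 \<le> Z x"
      for R :: "'c measure" and Z W :: "'c \<Rightarrow> real" and i
      using int[OF that, of "\<lambda>x. x ^ i" 1] by (auto simp: power_le_one)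
    have expand: "(\<integral>x. g (exp (- Z x)) * W x \<partial>R) = (\<Sum>i\<le>n. a i * (\<integral>x. exp (- real i * Z x) * W x \<partial>R))"
      if "integrable R W" "Z \<in> borel_measurable R" "AE x in R. 0 \<le> Z x"
      for R :: "'c measure" and Z W :: "'c \<Rightarrow> real"
      using power[OF that]
      by (simp add: g_eq sum_distrib_right mult.assoc Bochner_Integration.integral_sum
          flip: exp_of_nat_mult)
    have eq_g: "?I g = ?J g"
      using expand[OF W1 _ Z1] expand[OF W2 _ Z2] eq by simp
    have diff: "\<bar>(\<integral>x. u (exp (- Z x)) * W x \<partial>R) - (\<integral>x. g (exp (- Z x)) * W x \<partial>R)\<bar> \<le> e * (\<integral>x. \<bar>W x\<bar> \<partial>R)"
      if "integrable R W" "Z \<in> borel_measurable R" "AE x in R. 0 \<le> Z x"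
      for R :: "'c measure" and Z W :: "'c \<Rightarrow> real"
    proof -
      have [measurable]: "Z \<in> borel_measurable R" "W \<in> borel_measurable R"
        using that by auto
      have bg: "\<bar>g x\<bar> \<le> B + e" if "x \<in> {0..1}" for x
        using B[OF that] g(2)[OF that] by linarith
      have i1: "integrable R (\<lambda>x. u (exp (- Z x)) * W x)"
        by (rule int[OF that _ B]) auto
      have i2: "integrable R (\<lambda>x. g (exp (- Z x)) * W x)"
        by (rule int[OF that _ bg]) auto
      have "\<bar>(\<integral>x. u (exp (- Z x)) * W x \<partial>R) - (\<integral>x. g (exp (- Z x)) * W x \<partial>R)\<bar>
          = \<bar>\<integral>x. u (exp (- Z x)) * W x - g (exp (- Z x)) * W x \<partial>R\<bar>"
        using i1 i2 by simp
      also have "\<dots> \<le> (\<integral>x. \<bar>u (exp (- Z x)) * W x - g (exp (- Z x)) * W x\<bar> \<partial>R)"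
        using integral_norm_bound[of R "\<lambda>x. u (exp (- Z x)) * W x - g (exp (- Z x)) * W x"] by simp
      also have "\<dots> \<le> (\<integral>x. e * \<bar>W x\<bar> \<partial>R)"
      proof (rule integral_mono_AE)
        show "AE x in R. \<bar>u (exp (- Z x)) * W x - g (exp (- Z x)) * W x\<bar> \<le> e * \<bar>W x\<bar>"
          using that(3)
        proof eventually_elim
          case (elim x)
          then have "\<bar>u (exp (- Z x)) - g (exp (- Z x))\<bar> \<le> e"
            using g(2)[of "exp (- Z x)"] by auto
          then have "\<bar>u (exp (- Z x)) - g (exp (- Z x))\<bar> * \<bar>W x\<bar> \<le> e * \<bar>W x\<bar>"
            by (rule mult_right_mono) simp
          then show ?case by (simp add: abs_mult[symmetric] left_diff_distrib)
        qed
      qed (use i1 i2 that(1) in auto)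
      finally show ?thesis by simp
    qed
    from diff[OF W1 _ Z1] diff[OF W2 _ Z2] eq_g show ?thesis
      by (simp add: distrib_left)
  qed
  have "?I u - ?J u = 0"
  proof (rule ccontr)
    assume ne: "?I u - ?J u \<noteq> 0"
    have "0 \<le> (\<integral>x. \<bar>W1 x\<bar> \<partial>P)" "0 \<le> (\<integral>x. \<bar>W2 x\<bar> \<partial>Q)" by simp_all
    then have K: "?K \<ge> 0" by linarith
    then have K': "2 * (?K + 1) > 0" by (intro mult_pos_pos) linarith+
    \<comment> \<open>A gap d between the integrals is refuted with e = d / (2 (?K + 1)), which
      yields d <= d * ?K / (2 (?K + 1)) < d. The summand 1 keeps the quotient defined when both
      weights have mass zero.\<close>
    from K have "\<bar>?I u - ?J u\<bar> \<le> (\<bar>?I u - ?J u\<bar> / (?K + 1) / 2) * ?K"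
      using ne by (intro close) (auto simp: add_nonneg_pos)
    also have "\<dots> = \<bar>?I u - ?J u\<bar> * (?K / (2 * (?K + 1)))" by simp
    also have "\<dots> < \<bar>?I u - ?J u\<bar> * 1"
      using K K' ne by (intro mult_strict_left_mono) (subst divide_less_eq_1_pos, simp_all)
    finally show False by simp
  qed
  then show ?thesis by simp
qed

text \<open>
  Weights of arbitrary sign are allowed because the positivity of the Mittag-Leffler density is
  not known beforehand.
\<close>

lemma laplace_signed_unique:
  fixes Z1 W1 :: "'a \<Rightarrow> real" and Z2 W2 :: "'b \<Rightarrow> real"
  assumes [measurable]: "Z1 \<in> borel_measurable P" "Z2 \<in> borel_measurable Q"
    and W1: "integrable P W1" and W2: "integrable Q W2"
    and Z1: "AE x in P. 0 \<le> Z1 x" and Z2: "AE x in Q. 0 \<le> Z2 x"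
    and eq: "\<And>n::nat. (\<integral>x. exp (- real n * Z1 x) * W1 x \<partial>P) = (\<integral>x. exp (- real n * Z2 x) * W2 x \<partial>Q)"
    and A: "A \<in> sets borel"
  shows "(\<integral>x. indicator A (Z1 x) * W1 x \<partial>P) = (\<integral>x. indicator A (Z2 x) * W2 x \<partial>Q)"
proof -
  have [measurable]: "W1 \<in> borel_measurable P" "W2 \<in> borel_measurable Q"
    using W1 W2 by auto
  have int: "integrable R (\<lambda>x. indicator B (Z x) * W x)"
    if "integrable R W" "Z \<in> borel_measurable R" "B \<in> sets borel"
    for R :: "'c measure" and Z W :: "'c \<Rightarrow> real" and B
  proof (rule Bochner_Integration.integrable_bound[OF that(1)])
    have [measurable]: "Z \<in> borel_measurable R" "W \<in> borel_measurable R" "B \<in> sets borel"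
      using that by auto
    show "(\<lambda>x. indicator B (Z x) * W x) \<in> borel_measurable R" by measurable
  qed (auto simp: indicator_def)
  have sums: "(\<lambda>i. \<integral>x. indicator (B i) (Z x) * W x \<partial>R) sums (\<integral>x. indicator (\<Union>i. B i) (Z x) * W x \<partial>R)"
    if "integrable R W" "Z \<in> borel_measurable R" "\<And>i. B i \<in> sets borel" "disjoint_family B"
    for R :: "'c measure" and Z W :: "'c \<Rightarrow> real" and B :: "nat \<Rightarrow> real set"
  proof -
    have [measurable]: "Z \<in> borel_measurable R" "W \<in> borel_measurable R"
      using that by auto
    have [measurable]: "\<And>i. B i \<in> sets borel" "(\<Union>i. B i) \<in> sets borel"
      using that by auto
    have ind: "(\<Sum>i<n. indicator (B i) y) = (indicator (\<Union>i<n. B i) y :: real)" for n y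
      by (subst indicator_UN_disjoint)
        (use \<open>disjoint_family B\<close> in \<open>auto simp: disjoint_family_on_def\<close>)
    have "(\<lambda>n. \<integral>x. (\<Sum>i<n. indicator (B i) (Z x)) * W x \<partial>R)
        \<longlonglongrightarrow> (\<integral>x. indicator (\<Union>i. B i) (Z x) * W x \<partial>R)"
    proof (rule integral_dominated_convergence)
      show "AE x in R. (\<lambda>n. (\<Sum>i<n. indicator (B i) (Z x)) * W x) \<longlonglongrightarrow> indicator (\<Union>i. B i) (Z x) * W x"
      proof (intro AE_I2 tendsto_mult tendsto_const)
        fix x
        show "(\<lambda>n. \<Sum>i<n. indicator (B i) (Z x)) \<longlonglongrightarrow> (indicator (\<Union>i. B i) (Z x) :: real)"
          using indicator_sums[of B "Z x"] \<open>disjoint_family B\<close>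
          by (auto simp: sums_def disjoint_family_on_def)
      qed
      show "AE x in R. norm ((\<Sum>i<n. indicator (B i) (Z x)) * W x) \<le> norm (W x)" for n
        unfolding ind by (auto simp: indicator_def)
      show "integrable R (\<lambda>x. norm (W x))" using that by simp
    qed (simp_all add: borel_measurable_times)
    then show ?thesis
      unfolding sums_def sum_distrib_right
      by (subst (asm) Bochner_Integration.integral_sum) (rule int[OF that(1-3)], simp)
  qed
  \<comment> \<open>Dynkin induction from the half-lines {..a}, an intersection-stable generator of
    the Borel sets. Linearity handles complements, dominated convergence handles disjoint
    unions.\<close>
  have "Int_stable (range (atMost :: real \<Rightarrow> real set))" "range (atMost :: real \<Rightarrow> real set) \<subseteq> Pow UNIV"
    "A \<in> sigma_sets UNIV (range atMost)"
    using A unfolding borel_eq_atMost by (auto simp: Int_stable_def)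
  then show ?thesis
  proof (induction rule: sigma_sets_induct_disjoint)
    case (basic A)
    then obtain a where A_eq: "A = {..a}" by auto
    define c where "c = exp (- a)"
    \<comment> \<open>z <= a means exp (- z) >= c. The ramp \<open>u k\<close> equals 1 from c
      upwards and 0 below c - 1/k, so these continuous functions decrease to the indicator of
      {c..}.\<close>
    define u where "u k z = min 1 (max 0 (1 + real k * (z - c)))" for k :: nat and z
    have u01: "\<bar>u k z\<bar> \<le> 1" for k z by (auto simp: u_def)
    have cont: "continuous_on S (u k)" for k S
      unfolding u_def by (intro continuous_intros)
    have [measurable]: "u k \<in> borel_measurable borel" for k
      using borel_measurable_continuous_onI[OF cont] .
    have lim: "(\<lambda>k. u k (exp (- z))) \<longlonglongrightarrow> (indicator {..a} z :: real)" for z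
    proof (cases "z \<le> a")
      case True
      then have "u k (exp (- z)) = 1" for k
        by (auto simp: u_def c_def min_def max_def)
      with True show ?thesis by simp
    next
      case False
      define d where "d = c - exp (- z)"
      have "d > 0" using False by (simp add: d_def c_def)
      obtain k0 :: nat where k0: "real k0 > 1 / d" using reals_Archimedean2 by auto
      have "eventually (\<lambda>k. u k (exp (- z)) = 0) sequentially"
        using eventually_ge_at_top[of k0]
      proof eventually_elim
        case (elim k)
        then have "real k * d > 1"
          using k0 \<open>d > 0\<close> by (simp add: divide_less_eq) (smt (verit) mult_right_mono of_nat_le_iff)
        then show ?case by (auto simp: u_def d_def algebra_simps)
      qed
      then show ?thesis using False by (simp add: tendsto_eventually)
    qed
    have conv: "(\<lambda>k. \<integral>x. u k (exp (- Z x)) * W x \<partial>R) \<longlonglongrightarrow> (\<integral>x. indicator A (Z x) * W x \<partial>R)"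
      if "integrable R W" "Z \<in> borel_measurable R"
      for R :: "'c measure" and Z W :: "'c \<Rightarrow> real"
    proof (rule integral_dominated_convergence)
      have [measurable]: "Z \<in> borel_measurable R" "W \<in> borel_measurable R"
        using that by auto
      show "(\<lambda>x. indicator A (Z x) * W x) \<in> borel_measurable R"
        unfolding A_eq by measurable
      show "(\<lambda>x. u k (exp (- Z x)) * W x) \<in> borel_measurable R" for k
        by measurable
      show "integrable R (\<lambda>x. norm (W x))" using that by simp
      show "AE x in R. (\<lambda>k. u k (exp (- Z x)) * W x) \<longlonglongrightarrow> indicator A (Z x) * W x"
        unfolding A_eq by (intro AE_I2 tendsto_mult lim tendsto_const)
      show "AE x in R. norm (u k (exp (- Z x)) * W x) \<le> norm (W x)" for k
        using u01 by (auto simp: abs_mult mult_left_le_one_le)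
    qed
    have "(\<integral>x. u k (exp (- Z1 x)) * W1 x \<partial>P) = (\<integral>x. u k (exp (- Z2 x)) * W2 x \<partial>Q)" for k
      by (rule laplace_continuous_weight_eq[OF _ _ W1 W2 Z1 Z2 eq cont]) auto
    with conv[OF W1, of Z1] conv[OF W2, of Z2] show ?case
      using LIMSEQ_unique by auto
  next
    case empty
    then show ?case by simp
  next
    case (compl B)
    then have B: "B \<in> sets borel" by (simp add: borel_eq_atMost)
    \<comment> \<open>The total mass is written as the transform at n = 0, so that \<open>eq\<close>
      also covers it.\<close>
    have split: "(\<integral>x. indicator (UNIV - B) (Z x) * W x \<partial>R) =
        (\<integral>x. exp (- real 0 * Z x) * W x \<partial>R) - (\<integral>x. indicator B (Z x) * W x \<partial>R)"
      if "integrable R W" "Z \<in> borel_measurable R"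
      for R :: "'c measure" and Z W :: "'c \<Rightarrow> real"
    proof -
      have "(\<integral>x. indicator (UNIV - B) (Z x) * W x \<partial>R) = (\<integral>x. W x - indicator B (Z x) * W x \<partial>R)"
        by (rule Bochner_Integration.integral_cong) (auto simp: indicator_def)
      then show ?thesis using int[OF that B] that by simp
    qed
    show ?case
      using split[OF W1, of Z1] split[OF W2, of Z2] eq[of 0] compl by simp
  next
    case (union B)
    then have B: "B i \<in> sets borel" for i by (auto simp: borel_eq_atMost)
    have "(\<lambda>i. \<integral>x. indicator (B i) (Z1 x) * W1 x \<partial>P) sums (\<integral>x. indicator (\<Union>i. B i) (Z1 x) * W1 x \<partial>P)"
      by (rule sums[OF W1 _ B]) (use union in auto)
    moreover have "(\<lambda>i. \<integral>x. indicator (B i) (Z2 x) * W2 x \<partial>Q) sums (\<integral>x. indicator (\<Union>i. B i) (Z2 x) * W2 x \<partial>Q)"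
      by (rule sums[OF W2 _ B]) (use union in auto)
    ultimately show ?case using union.IH sums_unique2 by simp
  qed
qed

subsection \<open>Random times\<close>

text \<open>
  The grid point next to \<open>x\<close> is taken strictly above it, so that right-continuity
  suffices to pass to the limit.
\<close>

definition grid_above :: "nat \<Rightarrow> real \<Rightarrow> real" where
  "grid_above n x = real (Suc (nat \<lfloor>real (Suc n) * x\<rfloor>)) / real (Suc n)"

lemma grid_above_nonneg: "0 \<le> grid_above n x"
  by (simp add: grid_above_def)

lemma grid_above_bounds:
  assumes "0 \<le> x"
  shows "x < grid_above n x" "grid_above n x \<le> x + 1 / real (Suc n)"
proof -
  define m where "m = real (Suc n)"
  define k where "k = nat \<lfloor>m * x\<rfloor>"
  have m: "0 < m" by (simp add: m_def)
  have eq: "grid_above n x = (real k + 1) / m"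
    by (simp add: grid_above_def m_def k_def add.commute)
  have k: "real k \<le> m * x" "m * x < real k + 1"
    using assms m floor_correct[of "m * x"] unfolding k_def by simp_all
  from k(2) m show "x < grid_above n x"
    unfolding eq by (simp add: pos_less_divide_eq mult.commute)
  have "grid_above n x = real k / m + 1 / m"
    unfolding eq by (rule add_divide_distrib)
  also have "real k / m \<le> x"
    using k(1) m by (simp add: pos_divide_le_eq mult.commute)
  finally show "grid_above n x \<le> x + 1 / real (Suc n)"
    by (simp add: m_def)
qed

lemma grid_above_tendsto:
  assumes "0 \<le> x"
  shows "(\<lambda>n. grid_above n x) \<longlonglongrightarrow> x"
proof (rule tendsto_sandwich[where f = "\<lambda>_. x" and h = "\<lambda>n. x + 1 / real (Suc n)"])
  show "(\<lambda>n. x + 1 / real (Suc n)) \<longlonglongrightarrow> x"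
    using tendsto_add[OF tendsto_const[of x] LIMSEQ_inverse_real_of_nat]
    by (simp add: inverse_eq_divide)
  show "\<forall>\<^sub>F n in sequentially. x \<le> grid_above n x"
    using grid_above_bounds(1)[OF assms] by (intro always_eventually allI less_imp_le)
  show "\<forall>\<^sub>F n in sequentially. grid_above n x \<le> x + 1 / real (Suc n)"
    using grid_above_bounds(2)[OF assms] by (intro always_eventually allI)
qed simp

lemma right_continuous_grid_above:
  fixes f :: "real \<Rightarrow> real"
  assumes "0 \<le> x" "continuous (at_right x) f"
  shows "(\<lambda>n. f (grid_above n x)) \<longlonglongrightarrow> f x"
proof -
  have "filterlim (\<lambda>n. grid_above n x) (at_right x) sequentially"
    unfolding filterlim_at
    using grid_above_tendsto[OF assms(1)] grid_above_bounds(1)[OF assms(1)]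
    by (auto intro!: always_eventually less_imp_neq[symmetric])
  with assms(2) show ?thesis
    unfolding continuous_within by (rule filterlim_compose)
qed

lemma measurable_grid_above [measurable]: "grid_above n \<in> borel_measurable borel"
  unfolding grid_above_def by measurable

text \<open>The grid time has countably many values, all of them nonnegative, so measurability of
  each single \<open>Z t\<close> with t >= 0 is enough; joint measurability in time and \<omega> is
  not assumed.\<close>

lemma measurable_time_grid:
  fixes Z :: "real \<Rightarrow> 'a \<Rightarrow> real"
  assumes "\<And>t. 0 \<le> t \<Longrightarrow> Z t \<in> borel_measurable M" and [measurable]: "T \<in> borel_measurable M"
  shows "(\<lambda>\<omega>. Z (grid_above n (T \<omega>)) \<omega>) \<in> borel_measurable M"
  unfolding grid_above_def
  by (rule measurable_compose_countable[where f = "\<lambda>k \<omega>. Z (real (Suc k) / real (Suc n)) \<omega>"])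
    (rule assms(1), simp, measurable)

text \<open>A measurable version of Z at time T. As a limit along the grid it is measurable on the
  whole space, bad paths included, whereas Z (T \<omega>) \<omega> agrees with it only where T
  \<omega> >= 0 and the path is right-continuous at T \<omega>.\<close>

definition grid_time_change :: "(real \<Rightarrow> 'a \<Rightarrow> real) \<Rightarrow> ('a \<Rightarrow> real) \<Rightarrow> 'a \<Rightarrow> real" where
  "grid_time_change Z T \<omega> = lim (\<lambda>n. Z (grid_above n (T \<omega>)) \<omega>)"

lemma measurable_grid_time_change:
  assumes "\<And>t. 0 \<le> t \<Longrightarrow> Z t \<in> borel_measurable M" and "T \<in> borel_measurable M"
  shows "grid_time_change Z T \<in> borel_measurable M"
  unfolding grid_time_change_def
  by (rule borel_measurable_lim_metric) (rule measurable_time_grid[OF assms])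

lemma grid_time_change_eq:
  assumes "0 \<le> T \<omega>" "continuous (at_right (T \<omega>)) (\<lambda>s. Z s \<omega>)"
  shows "grid_time_change Z T \<omega> = Z (T \<omega>) \<omega>"
  unfolding grid_time_change_def
  using right_continuous_grid_above[OF assms] by (rule limI)

section \<open>Expectations at independent random indices and times\<close>

context prob_space
begin

text \<open>Conditioning on a discrete index: on J < n the expectation is a finite sum over the
  events J = j, each term factorises by independence, and the bound 1 lets n tend to infinity on
  both sides.\<close>

lemma expectation_countable_mixture:
  fixes F :: "nat \<Rightarrow> 'a \<Rightarrow> real"
  assumes J [measurable]: "J \<in> measurable M (count_space UNIV)"
    and F [measurable]: "\<And>j. F j \<in> borel_measurable M"
    and F01: "AE \<omega> in M. \<forall>j. 0 \<le> F j \<omega> \<and> F j \<omega> \<le> 1"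
    and indep: "\<And>j. indep_var borel (F j) borel (\<lambda>\<omega>. indicator {j} (J \<omega>))"
  shows "expectation (\<lambda>\<omega>. F (J \<omega>) \<omega>) = expectation (\<lambda>\<omega>. expectation (F (J \<omega>)))"
proof -
  define a where "a j = expectation (F j)" for j
  have intF: "integrable M (F j)" for j
    by (rule integrable_const_bound[where B = 1]) (use F01 in auto)
  have a01: "0 \<le> a j" "a j \<le> 1" for j
  proof -
    show "0 \<le> a j" unfolding a_def by (rule integral_nonneg_AE) (use F01 in auto)
    have "expectation (F j) \<le> expectation (\<lambda>_. 1)"
      by (rule integral_mono_AE) (use F01 intF in auto)
    then show "a j \<le> 1" by (simp add: a_def prob_space)
  qed
  have sum_ind: "(\<Sum>j<n. c j * indicator {j} i) = (indicator {..<n} i * c i :: real)" for n i :: nat and c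
    by (auto simp: indicator_def sum.delta if_distrib[of "\<lambda>x. _ * x"] cong: if_cong)
  have lim_ind: "(\<lambda>n. indicator {..<n} i * c) \<longlonglongrightarrow> (c :: real)" for i :: nat and c
    by (rule tendsto_eventually) (use eventually_gt_at_top[of i] in eventually_elim, simp)
  have m1 [measurable]: "(\<lambda>\<omega>. F (J \<omega>) \<omega>) \<in> borel_measurable M"
    by (rule measurable_compose_countable[OF F J])
  have m2 [measurable]: "(\<lambda>\<omega>. a (J \<omega>)) \<in> borel_measurable M"
    by measurable
  have "(\<lambda>n. expectation (\<lambda>\<omega>. indicator {..<n} (J \<omega>) * F (J \<omega>) \<omega>)) \<longlonglongrightarrow> expectation (\<lambda>\<omega>. F (J \<omega>) \<omega>)"
  proof (rule integral_dominated_convergence[where w = "\<lambda>_. 1"])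
    show "AE \<omega> in M. norm (indicator {..<n} (J \<omega>) * F (J \<omega>) \<omega>) \<le> 1" for n
      using F01 by eventually_elim (auto simp: indicator_def)
    show "(\<lambda>\<omega>. indicator {..<n} (J \<omega>) * F (J \<omega>) \<omega>) \<in> borel_measurable M" for n
      by (rule borel_measurable_times[OF measurable_compose[OF J] m1]) simp
  qed (auto intro: lim_ind)
  moreover have "(\<lambda>n. expectation (\<lambda>\<omega>. indicator {..<n} (J \<omega>) * a (J \<omega>))) \<longlonglongrightarrow> expectation (\<lambda>\<omega>. a (J \<omega>))"
  proof (rule integral_dominated_convergence[where w = "\<lambda>_. 1"])
    show "AE \<omega> in M. norm (indicator {..<n} (J \<omega>) * a (J \<omega>)) \<le> 1" for n
      using a01 by (auto simp: indicator_def)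
    show "(\<lambda>\<omega>. indicator {..<n} (J \<omega>) * a (J \<omega>)) \<in> borel_measurable M" for n
      by (rule borel_measurable_times[OF measurable_compose[OF J] m2]) simp
  qed (auto intro: lim_ind)
  moreover have "expectation (\<lambda>\<omega>. indicator {..<n} (J \<omega>) * F (J \<omega>) \<omega>)
      = expectation (\<lambda>\<omega>. indicator {..<n} (J \<omega>) * a (J \<omega>))" for n
  proof -
    have int_ind: "integrable M (\<lambda>\<omega>. indicator {j} (J \<omega>) :: real)" for j
      by (rule integrable_const_bound[where B = 1]) (auto intro!: measurable_compose[OF J])
    have "expectation (\<lambda>\<omega>. \<Sum>j<n. F j \<omega> * indicator {j} (J \<omega>))
        = (\<Sum>j<n. expectation (\<lambda>\<omega>. F j \<omega> * indicator {j} (J \<omega>)))"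
      by (rule Bochner_Integration.integral_sum) (rule indep_var_integrable[OF indep intF int_ind])
    also have "\<dots> = (\<Sum>j<n. a j * expectation (\<lambda>\<omega>. indicator {j} (J \<omega>)))"
      unfolding a_def by (intro sum.cong refl indep_var_lebesgue_integral[OF indep intF int_ind])
    also have "\<dots> = expectation (\<lambda>\<omega>. \<Sum>j<n. a j * indicator {j} (J \<omega>))"
      using int_ind
      by (subst Bochner_Integration.integral_sum) (simp_all only: integrable_mult_right integral_mult_right_zero)
    finally show ?thesis unfolding sum_ind .
  qed
  ultimately show ?thesis
    unfolding a_def[symmetric] using LIMSEQ_unique by auto
qed

text \<open>The sigma-algebra generated by f o U lies inside the one generated by U. This is the way
  back from \<open>independent_elements\<close> to \<open>indep_var\<close>, whose two value spaces
  share a type.\<close>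

lemma independent_elements_compose:
  assumes UV: "independent_elements M S U T V"
    and f: "f \<in> measurable S R" and g: "g \<in> measurable T R'"
  shows "indep_var R (\<lambda>\<omega>. f (U \<omega>)) R' (\<lambda>\<omega>. g (V \<omega>))"
proof -
  have U [measurable]: "U \<in> measurable M S" and V [measurable]: "V \<in> measurable M T"
    and ind: "indep_set (sets (vimage_algebra (space M) U S)) (sets (vimage_algebra (space M) V T))"
    using UV by (auto simp: independent_elements_def)
  note f [measurable] g [measurable]
  have sub1: "sigma_sets (space M) {(\<lambda>\<omega>. f (U \<omega>)) -` A \<inter> space M |A. A \<in> sets R}
      \<subseteq> sets (vimage_algebra (space M) U S)"
  proof -
    have "(\<lambda>\<omega>. f (U \<omega>)) \<in> measurable (vimage_algebra (space M) U S) R"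
      using measurable_space[OF U]
      by (intro measurable_compose[OF measurable_vimage_algebra1 f]) auto
    then have "{(\<lambda>\<omega>. f (U \<omega>)) -` A \<inter> space M |A. A \<in> sets R} \<subseteq> sets (vimage_algebra (space M) U S)"
      by (auto dest: measurable_sets)
    then show ?thesis
      using sets.sigma_sets_subset[of _ "vimage_algebra (space M) U S"] by simp
  qed
  have sub2: "sigma_sets (space M) {(\<lambda>\<omega>. g (V \<omega>)) -` A \<inter> space M |A. A \<in> sets R'}
      \<subseteq> sets (vimage_algebra (space M) V T)"
  proof -
    have "(\<lambda>\<omega>. g (V \<omega>)) \<in> measurable (vimage_algebra (space M) V T) R'"
      using measurable_space[OF V]
      by (intro measurable_compose[OF measurable_vimage_algebra1 g]) auto
    then have "{(\<lambda>\<omega>. g (V \<omega>)) -` A \<inter> space M |A. A \<in> sets R'} \<subseteq> sets (vimage_algebra (space M) V T)"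
      by (auto dest: measurable_sets)
    then show ?thesis
      using sets.sigma_sets_subset[of _ "vimage_algebra (space M) V T"] by simp
  qed
  have "indep_set (sigma_sets (space M) {(\<lambda>\<omega>. f (U \<omega>)) -` A \<inter> space M |A. A \<in> sets R})
     (sigma_sets (space M) {(\<lambda>\<omega>. g (V \<omega>)) -` A \<inter> space M |A. A \<in> sets R'})"
    using ind unfolding indep_set_def
    by (rule indep_sets_mono_sets) (use sub1 sub2 in \<open>auto split: bool.split\<close>)
  then show ?thesis
    unfolding indep_var_eq by simp
qed

text \<open>Given T, the transform of D T is exp (- c T). On the grid this is a countable mixture,
  where each term involves a single \<open>D r\<close>; hence independence of T from every single
  \<open>D t\<close> suffices. Right-continuity and the bound 1 then carry both sides to the
  limit.\<close>

lemma laplace_grid_time_change: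
  fixes D :: "real \<Rightarrow> 'a \<Rightarrow> real"
  assumes D [measurable]: "\<And>t. 0 \<le> t \<Longrightarrow> D t \<in> borel_measurable M"
    and D_nonneg: "AE \<omega> in M. \<forall>t\<ge>0. 0 \<le> D t \<omega>"
    and D_cont: "AE \<omega> in M. \<forall>t\<ge>0. continuous (at_right t) (\<lambda>s. D s \<omega>)"
    and laplace: "\<And>t. 0 \<le> t \<Longrightarrow> expectation (\<lambda>\<omega>. exp (- s * D t \<omega>)) = exp (- t * c)"
    and s: "0 < s" and c: "0 \<le> c"
    and T [measurable]: "T \<in> borel_measurable M" and T_nonneg: "AE \<omega> in M. 0 \<le> T \<omega>"
    and indep: "\<And>t. 0 \<le> t \<Longrightarrow> indep_var borel (D t) borel T"
  shows "expectation (\<lambda>\<omega>. exp (- s * grid_time_change D T \<omega>)) = expectation (\<lambda>\<omega>. exp (- c * T \<omega>))"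
proof -
  note [measurable] = measurable_grid_time_change[OF D T] measurable_time_grid[OF D T]
  have "(\<lambda>n. expectation (\<lambda>\<omega>. exp (- s * D (grid_above n (T \<omega>)) \<omega>)))
      \<longlonglongrightarrow> expectation (\<lambda>\<omega>. exp (- s * grid_time_change D T \<omega>))"
  proof (rule integral_dominated_convergence[where w = "\<lambda>_. 1"])
    show "AE \<omega> in M. (\<lambda>n. exp (- s * D (grid_above n (T \<omega>)) \<omega>)) \<longlonglongrightarrow> exp (- s * grid_time_change D T \<omega>)"
      using T_nonneg D_cont
    proof eventually_elim
      case (elim \<omega>)
      then show ?case
        using right_continuous_grid_above[of "T \<omega>" "\<lambda>s. D s \<omega>"]
        by (auto simp: grid_time_change_eq intro!: tendsto_exp tendsto_minus tendsto_mult tendsto_const)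
    qed
    show "AE \<omega> in M. norm (exp (- s * D (grid_above n (T \<omega>)) \<omega>)) \<le> 1" for n
      using D_nonneg by eventually_elim (use s in \<open>auto simp: grid_above_nonneg\<close>)
  qed auto
  moreover have "(\<lambda>n. expectation (\<lambda>\<omega>. exp (- c * grid_above n (T \<omega>))))
      \<longlonglongrightarrow> expectation (\<lambda>\<omega>. exp (- c * T \<omega>))"
  proof (rule integral_dominated_convergence[where w = "\<lambda>_. 1"])
    show "AE \<omega> in M. (\<lambda>n. exp (- c * grid_above n (T \<omega>))) \<longlonglongrightarrow> exp (- c * T \<omega>)"
      using T_nonneg by eventually_elim (intro tendsto_intros grid_above_tendsto)
  qed (use c in \<open>auto simp: grid_above_nonneg\<close>)
  moreover have "expectation (\<lambda>\<omega>. exp (- s * D (grid_above n (T \<omega>)) \<omega>))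
      = expectation (\<lambda>\<omega>. exp (- c * grid_above n (T \<omega>)))" for n
  proof -
    \<comment> \<open>\<open>J\<close> is the index of the grid cell that contains T, and
      \<open>r j\<close> is the right end of cell j.\<close>
    define J where "J \<omega> = nat \<lfloor>real (Suc n) * T \<omega>\<rfloor>" for \<omega>
    define r where "r j = real (Suc j) / real (Suc n)" for j
    have r: "0 \<le> r j" for j by (simp add: r_def)
    have grid: "grid_above n (T \<omega>) = r (J \<omega>)" for \<omega>
      by (simp add: grid_above_def J_def r_def)
    have [measurable]: "J \<in> measurable M (count_space UNIV)"
      unfolding J_def by measurable
    have "expectation (\<lambda>\<omega>. exp (- s * D (r (J \<omega>)) \<omega>))
        = expectation (\<lambda>\<omega>. expectation (\<lambda>\<omega>'. exp (- s * D (r (J \<omega>)) \<omega>')))"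
    proof (rule expectation_countable_mixture)
      show "AE \<omega> in M. \<forall>j. 0 \<le> exp (- s * D (r j) \<omega>) \<and> exp (- s * D (r j) \<omega>) \<le> 1"
        using D_nonneg by eventually_elim (use s r in auto)
      fix j
      show "(\<lambda>\<omega>. exp (- s * D (r j) \<omega>)) \<in> borel_measurable M"
        using r D by measurable
      have "indep_var borel ((\<lambda>x. exp (- s * x)) \<circ> D (r j))
          borel ((\<lambda>x. indicator {j} (nat \<lfloor>real (Suc n) * x\<rfloor>)) \<circ> T)"
        by (rule indep_var_compose[OF indep[OF r]]) measurable
      then show "indep_var borel (\<lambda>\<omega>. exp (- s * D (r j) \<omega>)) borel (\<lambda>\<omega>. indicator {j} (J \<omega>))"
        by (simp add: comp_def J_def)
    qed measurable
    then show ?thesis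
      using laplace r by (simp add: grid mult.commute)
  qed
  ultimately show ?thesis using LIMSEQ_unique by auto
qed

text \<open>For a fixed number n of jumps, independence gives \<phi> ^ n; the random number K is
  then treated as a countable mixture.\<close>

lemma laplace_compound:
  fixes X :: "nat \<Rightarrow> 'a \<Rightarrow> real"
  assumes K [measurable]: "K \<in> measurable M (count_space UNIV)"
    and X: "indep_vars (\<lambda>_. borel) X {1..}"
    and X_nonneg: "\<And>i. 1 \<le> i \<Longrightarrow> AE \<omega> in M. 0 \<le> X i \<omega>"
    and laplace: "\<And>i. 1 \<le> i \<Longrightarrow> expectation (\<lambda>\<omega>. exp (- s * X i \<omega>)) = \<phi>"
    and s: "0 < s"
    and indep: "\<And>n. indep_var borel (\<lambda>\<omega>. \<Sum>i=1..n. X i \<omega>) borel (\<lambda>\<omega>. indicator {n} (K \<omega>))"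
  shows "expectation (\<lambda>\<omega>. exp (- s * (\<Sum>i=1..K \<omega>. X i \<omega>))) = expectation (\<lambda>\<omega>. \<phi> ^ K \<omega>)"
proof -
  have X_meas [measurable]: "X i \<in> borel_measurable M" if "1 \<le> i" for i
    using X that by (auto simp: indep_vars_def)
  have X_all: "AE \<omega> in M. \<forall>i. 1 \<le> i \<longrightarrow> 0 \<le> X i \<omega>"
    using X_nonneg by (auto simp: AE_all_countable)
  have power: "expectation (\<lambda>\<omega>. exp (- s * (\<Sum>i=1..n. X i \<omega>))) = \<phi> ^ n" for n
  proof -
    have "expectation (\<lambda>\<omega>. exp (- s * (\<Sum>i=1..n. X i \<omega>)))
        = expectation (\<lambda>\<omega>. \<Prod>i=1..n. exp (- s * X i \<omega>))"
      by (simp add: sum_distrib_left exp_sum flip: sum_negf)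
    also have "\<dots> = (\<Prod>i=1..n. expectation (\<lambda>\<omega>. exp (- s * X i \<omega>)))"
    proof (rule indep_vars_lebesgue_integral)
      show "indep_vars (\<lambda>_. borel) (\<lambda>i \<omega>. exp (- s * X i \<omega>)) {1..n}"
        by (rule indep_vars_compose2[OF indep_vars_subset[OF X]]) auto
      show "integrable M (\<lambda>\<omega>. exp (- s * X i \<omega>))" if "i \<in> {1..n}" for i
      proof (rule integrable_const_bound[where B = 1])
        have [measurable]: "X i \<in> borel_measurable M"
          using X_meas that by simp
        show "AE \<omega> in M. norm (exp (- s * X i \<omega>)) \<le> 1"
          using X_all by eventually_elim (use s that in auto)
        show "(\<lambda>\<omega>. exp (- s * X i \<omega>)) \<in> borel_measurable M"
          by measurable
      qed
    qed simp
    also have "\<dots> = \<phi> ^ n" using laplace by simp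
    finally show ?thesis .
  qed
  have "expectation (\<lambda>\<omega>. exp (- s * (\<Sum>i=1..K \<omega>. X i \<omega>)))
      = expectation (\<lambda>\<omega>. expectation (\<lambda>\<omega>'. exp (- s * (\<Sum>i=1..K \<omega>. X i \<omega>'))))"
  proof (rule expectation_countable_mixture[where F = "\<lambda>n \<omega>. exp (- s * (\<Sum>i=1..n. X i \<omega>))"])
    show "AE \<omega> in M. \<forall>n. 0 \<le> exp (- s * (\<Sum>i=1..n. X i \<omega>)) \<and> exp (- s * (\<Sum>i=1..n. X i \<omega>)) \<le> 1"
      using X_all by eventually_elim (use s in \<open>auto intro!: sum_nonneg mult_nonneg_nonneg\<close>)
    fix n
    show "(\<lambda>\<omega>. exp (- s * (\<Sum>i=1..n. X i \<omega>))) \<in> borel_measurable M"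
      by measurable
    have "indep_var borel ((\<lambda>x. exp (- s * x)) \<circ> (\<lambda>\<omega>. \<Sum>i=1..n. X i \<omega>)) borel
        ((\<lambda>x. x) \<circ> (\<lambda>\<omega>. indicator {n} (K \<omega>)))"
      by (rule indep_var_compose[OF indep]) measurable
    then show "indep_var borel (\<lambda>\<omega>. exp (- s * (\<Sum>i=1..n. X i \<omega>))) borel (\<lambda>\<omega>. indicator {n} (K \<omega>))"
      by (simp add: comp_def)
  qed measurable
  then show ?thesis by (simp only: power)
qed

end

subsection \<open>The Mittag-Leffler distribution\<close>

text \<open>The substitution t = s x in the Euler integral of \<open>Gamma a\<close>. Working with
  nonnegative integrals yields integrability together with the value.\<close>

lemma gamma_laplace:
  fixes a s :: real
  assumes a: "0 < a" and s: "0 < s"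
  shows "has_bochner_integral lborel (\<lambda>x. indicator {0<..} x * (x powr (a - 1) * exp (- s * x))) (Gamma a / s powr a)"
proof (rule has_bochner_integral_nn_integral)
  let ?g = "\<lambda>t. ennreal (indicator {0..} t * t powr (a - 1) / exp t)"
  have eq: "indicator {0<..} x * (x powr (a - 1) * exp (- s * x))
      = (1 / s powr a) * (s * (indicator {0..} (s * x) * (s * x) powr (a - 1) / exp (s * x)))" for x
  proof (cases "x > 0")
    case True
    have "s powr a = s * s powr (a - 1)"
      using s by (simp add: powr_diff)
    with True s show ?thesis
      by (simp add: powr_mult exp_minus field_simps)
  next
    case False
    \<comment> \<open>The two indicators differ at x = 0, where \<open>0 powr (a - 1) = 0\<close>
      makes both sides vanish.\<close>
    with s show ?thesis by (auto simp: indicator_def zero_le_mult_iff)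
  qed
  have "(\<integral>\<^sup>+x. ennreal (indicator {0<..} x * (x powr (a - 1) * exp (- s * x))) \<partial>lborel)
      = (\<integral>\<^sup>+x. ennreal (1 / s powr a) * (ennreal s * ?g (0 + s * x)) \<partial>lborel)"
    unfolding eq using s by (simp add: ennreal_mult' divide_ennreal flip: ennreal_mult')
  also have "\<dots> = ennreal (1 / s powr a) * (ennreal s * (\<integral>\<^sup>+x. ?g (0 + s * x) \<partial>lborel))"
    by (simp add: nn_integral_cmult)
  also have "ennreal s * (\<integral>\<^sup>+x. ?g (0 + s * x) \<partial>lborel) = (\<integral>\<^sup>+x. ?g x \<partial>lborel)"
    using nn_integral_real_affine[of ?g s 0] s by simp
  also have "\<dots> = ennreal (Gamma a)"
    using Gamma_conv_nn_integral_real[OF a] by simp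
  also have "ennreal (1 / s powr a) * ennreal (Gamma a) = ennreal (Gamma a / s powr a)"
    by (simp flip: ennreal_mult')
  finally show "(\<integral>\<^sup>+x. ennreal (indicator {0<..} x * (x powr (a - 1) * exp (- s * x))) \<partial>lborel)
      = ennreal (Gamma a / s powr a)" .
  show "AE x in lborel. 0 \<le> indicator {0<..} x * (x powr (a - 1) * exp (- s * x))"
    by simp
  show "0 \<le> Gamma a / s powr a"
    using Gamma_real_pos[OF a] by simp
qed measurable

lemma measurable_mittag_leffler_density [measurable]:
  "mittag_leffler_density \<beta> \<eta> \<in> borel_measurable borel"
  unfolding mittag_leffler_density_def mittag_leffler_def by measurable

text \<open>Integrating the series termwise cancels the Gamma factors and leaves the geometric
  series with terms q (- q) ^ n, where q = \<eta> / s powr \<beta>. The hypothesis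
  \<open>large\<close> is q < 1, which makes the integrals of the norms summable.\<close>

lemma laplace_mittag_leffler_density:
  assumes \<beta>: "0 < \<beta>" and \<eta>: "0 < \<eta>" and s: "0 < s" and large: "\<eta> < s powr \<beta>"
  shows "has_bochner_integral lborel (\<lambda>x. exp (- s * x) * mittag_leffler_density \<beta> \<eta> x) (\<eta> / (\<eta> + s powr \<beta>))"
proof -
  define c where "c n = \<eta> * (- \<eta>) ^ n / Gamma (\<beta> * real n + \<beta>)" for n :: nat
  define e where "e n x = indicator {0<..} x * (x powr (\<beta> * real n + \<beta> - 1) * exp (- s * x))" for n :: nat and x
  define f where "f n x = c n * e n x" for n x
  define q where "q = \<eta> / s powr \<beta>"
  have q: "0 < q" "q < 1" using \<eta> s large by (auto simp: q_def)
  have pos: "0 < \<beta> * real n + \<beta>" for n using \<beta> by (simp add: add_nonneg_pos)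
  have G: "0 < Gamma (\<beta> * real n + \<beta>)" for n using pos by (rule Gamma_real_pos)
  have e: "has_bochner_integral lborel (e n) (Gamma (\<beta> * real n + \<beta>) / s powr (\<beta> * real n + \<beta>))" for n
    unfolding e_def using gamma_laplace[OF pos s] .
  have e_nonneg: "0 \<le> e n x" for n x by (simp add: e_def)
  have int_f: "integrable lborel (f n)" for n
    unfolding f_def using e by (auto simp: has_bochner_integral_iff)
  have s_pow: "s powr (\<beta> * real n + \<beta>) = (s powr \<beta>) ^ Suc n" for n
    using s by (simp add: powr_add powr_powr powr_realpow[symmetric] mult.commute)
  have integral_f: "integral\<^sup>L lborel (f n) = q * (- q) ^ n" for n
    unfolding f_def using e[of n] G[of n]
    by (simp add: has_bochner_integral_iff c_def s_pow q_def power_divide power_minus[of "\<eta> / _"]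
        power_minus[of \<eta>])
  have integral_norm: "(\<integral>x. norm (f n x) \<partial>lborel) = q * q ^ n" for n
    unfolding f_def using e[of n] G[of n] e_nonneg \<eta>
    by (simp add: has_bochner_integral_iff c_def s_pow q_def power_divide abs_mult power_abs)
  have summable_norm: "summable (\<lambda>n. \<integral>x. norm (f n x) \<partial>lborel)"
    unfolding integral_norm using q by (intro summable_mult summable_geometric) simp
  \<comment> \<open>By Tonelli the sum of the norms has a finite integral, hence is finite almost
    everywhere; this replaces an estimate of the growth of Gamma.\<close>
  have AE_summable: "AE x in lborel. summable (\<lambda>n. norm (f n x))"
  proof -
    have "(\<integral>\<^sup>+x. (\<Sum>n. ennreal (norm (f n x))) \<partial>lborel) = (\<Sum>n. \<integral>\<^sup>+x. ennreal (norm (f n x)) \<partial>lborel)"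
      using int_f by (intro nn_integral_suminf) auto
    also have "\<dots> = (\<Sum>n. ennreal (\<integral>x. norm (f n x) \<partial>lborel))"
      using int_f by (intro suminf_cong nn_integral_eq_integral) auto
    also have "\<dots> \<noteq> \<infinity>"
      unfolding infinity_ennreal_def by (rule ennreal_suminf_neq_top[OF summable_norm]) simp
    finally have "AE x in lborel. (\<Sum>n. ennreal (norm (f n x))) \<noteq> \<infinity>"
      using int_f by (intro nn_integral_noteq_infinite) auto
    then show ?thesis
      by eventually_elim (auto intro: summable_suminf_not_top)
  qed
  have suminf_f: "(\<Sum>n. f n x) = exp (- s * x) * mittag_leffler_density \<beta> \<eta> x"
    if "summable (\<lambda>n. norm (f n x))" for x
  proof (cases "x > 0")
    case False
    then show ?thesis by (simp add: f_def e_def mittag_leffler_density_def)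
  next
    case True
    define d where "d = \<eta> * x powr (\<beta> - 1) * exp (- s * x)"
    define g where "g n = (- \<eta> * x powr \<beta>) ^ n / Gamma (\<beta> * real n + \<beta>)" for n
    \<comment> \<open>Since d is nonzero, summability passes from \<open>f\<close> to the
      Mittag-Leffler series \<open>g\<close>, which justifies pulling d out of the infinite
      sum.\<close>
    have d: "d \<noteq> 0" using True \<eta> by (simp add: d_def)
    have fd: "f n x = d * g n" for n
    proof -
      have "x powr (\<beta> * real n + \<beta> - 1) = x powr (\<beta> - 1) * (x powr \<beta>) ^ n"
        using True by (simp add: powr_realpow[symmetric] powr_powr flip: powr_add) (simp add: algebra_simps)
      then show ?thesis
        using True by (simp add: f_def c_def e_def d_def g_def power_mult_distrib power_minus[of "\<eta> * _"] power_minus[of \<eta>])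
    qed
    have "summable (\<lambda>n. d * g n)"
      using summable_norm_cancel[OF that] by (simp add: fd)
    then have "summable g" using d by (simp add: summable_cmult_iff)
    then have "(\<Sum>n. f n x) = d * (\<Sum>n. g n)"
      unfolding fd by (rule suminf_mult)
    then show ?thesis
      using True by (simp add: d_def g_def mittag_leffler_density_def mittag_leffler_def)
  qed
  have AE_eq: "AE x in lborel. (\<Sum>n. f n x) = exp (- s * x) * mittag_leffler_density \<beta> \<eta> x"
    using AE_summable by eventually_elim (rule suminf_f)
  have "integrable lborel (\<lambda>x. \<Sum>n. f n x)"
    by (rule integrable_suminf[OF int_f AE_summable summable_norm])
  moreover have "(\<integral>x. (\<Sum>n. f n x) \<partial>lborel) = (\<Sum>n. q * (- q) ^ n)"
    unfolding integral_f[symmetric] by (rule integral_suminf[OF int_f AE_summable summable_norm])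
  moreover have "(\<Sum>n. q * (- q) ^ n) = \<eta> / (\<eta> + s powr \<beta>)"
  proof -
    have "(\<Sum>n. q * (- q) ^ n) = q * (1 / (1 - (- q)))"
      using q by (subst suminf_mult) (auto simp: summable_geometric suminf_geometric)
    also have "\<dots> = \<eta> / (\<eta> + s powr \<beta>)"
      using s \<eta> by (simp add: q_def field_simps)
    finally show ?thesis .
  qed
  ultimately have "has_bochner_integral lborel (\<lambda>x. \<Sum>n. f n x) (\<eta> / (\<eta> + s powr \<beta>))"
    by (simp add: has_bochner_integral_iff)
  then show ?thesis
    using AE_eq has_bochner_integral_cong_AE[of "\<lambda>x. \<Sum>n. f n x" lborel] int_f
    by (subst has_bochner_integral_cong_AE[symmetric, OF _ _ AE_eq]) (auto intro: borel_measurable_suminf)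
qed

text \<open>
  The power series of the density can be integrated termwise against \<open>exp (- s x)\<close> only if
  \<open>s powr \<beta> > \<eta>\<close>. Tilting both sides by \<open>exp (- s0 x)\<close> with \<open>s0\<close> large
  and applying uniqueness to the signed weight gives the law itself, and with it both the positivity
  of the density and its Laplace transform at every \<open>s > 0\<close>.
\<close>

lemma mittag_leffler_distr_eq:
  assumes P: "prob_space P" and V [measurable]: "V \<in> borel_measurable P" and V_nonneg: "AE x in P. 0 \<le> V x"
    and \<beta>: "0 < \<beta>" and \<eta>: "0 < \<eta>"
    and laplace: "\<And>s. 0 < s \<Longrightarrow> (\<integral>x. exp (- s * V x) \<partial>P) = \<eta> / (\<eta> + s powr \<beta>)"
  shows "density lborel (\<lambda>x. ennreal (mittag_leffler_density \<beta> \<eta> x)) = distr P borel V"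
proof -
  interpret P: prob_space P by fact
  let ?g = "mittag_leffler_density \<beta> \<eta>"
  \<comment> \<open>The choice makes s0 powr \<beta> = \<eta> + 1; by monotonicity every s0 + n is
    then large enough for termwise integration.\<close>
  obtain s0 :: real where s0: "0 < s0" "\<eta> < s0 powr \<beta>"
  proof
    show "0 < (\<eta> + 1) powr (1 / \<beta>)" using \<eta> by simp
    show "\<eta> < ((\<eta> + 1) powr (1 / \<beta>)) powr \<beta>" using \<eta> \<beta> by (simp add: powr_powr)
  qed
  have large: "0 < s0 + real n" "\<eta> < (s0 + real n) powr \<beta>" for n
  proof -
    show "0 < s0 + real n" using s0 by (simp add: add_pos_nonneg)
    have "s0 powr \<beta> \<le> (s0 + real n) powr \<beta>" using s0 \<beta> by (intro powr_mono2) auto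
    then show "\<eta> < (s0 + real n) powr \<beta>" using s0 by simp
  qed
  have g_zero: "?g x = 0" if "x \<le> 0" for x using that by (simp add: mittag_leffler_density_def)
  let ?w = "\<lambda>x. exp (- s0 * x)"
  have w_mult: "exp (- real n * x) * ?w x = exp (- (s0 + real n) * x)" for n x
    by (simp add: algebra_simps flip: exp_add)
  have int_g: "integrable lborel (\<lambda>x. ?w x * ?g x)"
    using laplace_mittag_leffler_density[OF \<beta> \<eta> s0] by (rule integrable.intros)
  have int_V: "integrable P (\<lambda>x. ?w (V x))"
    by (rule P.integrable_const_bound[where B = 1]) (use V_nonneg s0 in auto)
  have eq: "(\<integral>x. indicator A x * (?w x * ?g x) \<partial>lborel) = (\<integral>x. indicator A (V x) * ?w (V x) \<partial>P)"
    if A: "A \<in> sets borel" for A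
  proof -
    \<comment> \<open>Uniqueness requires a nonnegative variable, so the identity is replaced by
      \<open>max 0 x\<close>; the density vanishes where the two differ.\<close>
    have "(\<integral>x. indicator A (max 0 x) * (?w x * ?g x) \<partial>lborel) = (\<integral>x. indicator A (V x) * ?w (V x) \<partial>P)"
    proof (rule laplace_signed_unique[OF _ V int_g int_V _ V_nonneg _ A])
      fix n :: nat
      have "(\<integral>x. exp (- real n * max 0 x) * (?w x * ?g x) \<partial>lborel)
          = (\<integral>x. exp (- (s0 + real n) * x) * ?g x \<partial>lborel)"
      proof (rule Bochner_Integration.integral_cong[OF refl])
        fix x
        show "exp (- real n * max 0 x) * (?w x * ?g x) = exp (- (s0 + real n) * x) * ?g x"
          using w_mult[of n x] by (cases "x \<le> 0") (simp_all add: g_zero mult.assoc[symmetric])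
      qed
      also have "\<dots> = \<eta> / (\<eta> + (s0 + real n) powr \<beta>)"
        using laplace_mittag_leffler_density[OF \<beta> \<eta> large] by (rule has_bochner_integral_integral_eq)
      also have "\<dots> = (\<integral>x. exp (- (s0 + real n) * V x) \<partial>P)"
        using laplace[OF large(1)] by simp
      also have "\<dots> = (\<integral>x. exp (- real n * V x) * ?w (V x) \<partial>P)"
        by (simp only: w_mult)
      finally show "(\<integral>x. exp (- real n * max 0 x) * (?w x * ?g x) \<partial>lborel)
          = (\<integral>x. exp (- real n * V x) * ?w (V x) \<partial>P)" .
    qed auto
    moreover have "indicator A (max 0 x) * (?w x * ?g x) = indicator A x * (?w x * ?g x)" for x
      by (cases "x \<le> 0") (auto simp: g_zero max_def)
    ultimately show ?thesis by (simp only:)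
  qed
  have int_A: "integrable lborel (\<lambda>x. indicator A x * (?w x * ?g x))" if "A \<in> sets borel" for A
    using integrable_mult_indicator[OF _ int_g, of A] that by simp
  \<comment> \<open>Tested on the set where the density is negative, the left side of
    \<open>eq\<close> is at most 0 and the right side is at least 0. Both are therefore 0, and the
    set is null.\<close>
  have g_nonneg: "AE x in lborel. 0 \<le> ?g x"
  proof -
    define A where "A = {x. ?g x < 0}"
    have A: "A \<in> sets borel" unfolding A_def by measurable
    let ?h = "\<lambda>x. - (indicator A x * (?w x * ?g x))"
    have h: "0 \<le> ?h x" for x
      by (auto simp: A_def indicator_def mult_nonneg_nonpos)
    have "0 \<le> (\<integral>x. ?h x \<partial>lborel)" by (rule integral_nonneg_AE) (use h in auto)
    moreover have "(\<integral>x. ?h x \<partial>lborel) = - (\<integral>x. indicator A (V x) * ?w (V x) \<partial>P)"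
      using eq[OF A] by simp
    moreover have "0 \<le> (\<integral>x. indicator A (V x) * ?w (V x) \<partial>P)"
      by (rule integral_nonneg_AE) auto
    ultimately have "(\<integral>x. ?h x \<partial>lborel) = 0" by linarith
    then have "AE x in lborel. ?h x = 0"
      using h int_A[OF A] by (subst (asm) integral_nonneg_eq_0_iff_AE) auto
    then show ?thesis
      by eventually_elim (auto simp: A_def indicator_def split: if_splits)
  qed
  have weighted: "density (density lborel (\<lambda>x. ennreal (?g x))) (\<lambda>x. ennreal (?w x))
      = density (distr P borel V) (\<lambda>x. ennreal (?w x))"
  proof (rule measure_eqI)
    fix A assume "A \<in> sets (density (density lborel (\<lambda>x. ennreal (?g x))) (\<lambda>x. ennreal (?w x)))"
    then have A [measurable]: "A \<in> sets borel" by simp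
    have "emeasure (density (density lborel (\<lambda>x. ennreal (?g x))) (\<lambda>x. ennreal (?w x))) A
        = (\<integral>\<^sup>+x. ennreal (?g x) * ennreal (?w x) * indicator A x \<partial>lborel)"
      by (subst density_density_eq) (auto simp: emeasure_density)
    also have "\<dots> = (\<integral>\<^sup>+x. ennreal (indicator A x * (?w x * ?g x)) \<partial>lborel)"
      by (rule nn_integral_cong) (auto simp: indicator_def ennreal_mult'' mult.commute)
    also have "\<dots> = ennreal (\<integral>x. indicator A x * (?w x * ?g x) \<partial>lborel)"
      using g_nonneg by (intro nn_integral_eq_integral int_A A) auto
    also have "\<dots> = ennreal (\<integral>x. indicator A (V x) * ?w (V x) \<partial>P)"
      using eq[OF A] by simp
    also have "\<dots> = (\<integral>\<^sup>+x. ennreal (indicator A (V x) * ?w (V x)) \<partial>P)"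
    proof (rule nn_integral_eq_integral[symmetric])
      show "integrable P (\<lambda>x. indicator A (V x) * ?w (V x))"
        by (rule Bochner_Integration.integrable_bound[OF int_V]) (auto simp: indicator_def)
    qed auto
    also have "\<dots> = (\<integral>\<^sup>+x. ennreal (?w x) * indicator A x \<partial>distr P borel V)"
      by (subst nn_integral_distr) (auto intro!: nn_integral_cong simp: indicator_def)
    also have "\<dots> = emeasure (density (distr P borel V) (\<lambda>x. ennreal (?w x))) A"
      by (simp add: emeasure_density)
    finally show "emeasure (density (density lborel (\<lambda>x. ennreal (?g x))) (\<lambda>x. ennreal (?w x))) A
        = emeasure (density (distr P borel V) (\<lambda>x. ennreal (?w x))) A" .
  qed simp
  \<comment> \<open>The weight never vanishes, so multiplying by its reciprocal exp (s0 * x) undoes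
    the tilting.\<close>
  have unweight: "density (density N (\<lambda>x. ennreal (?w x))) (\<lambda>x. ennreal (exp (s0 * x))) = N"
    if "sets N = sets borel" for N :: "real measure"
  proof -
    have meas: "(\<lambda>x. ennreal (exp (c * x))) \<in> borel_measurable N" for c
      unfolding measurable_cong_sets[OF that refl] by measurable
    show ?thesis
      using meas[of "- s0"] meas[of s0]
      by (simp add: density_density_eq density_1 flip: ennreal_mult' exp_add)
  qed
  show ?thesis
    by (subst unweight[symmetric], simp, subst weighted, rule unweight, simp)
qed

section \<open>The stable subordinator at an independent exponential time\<close>

lemma distr_pair_snd_prob_space:
  assumes "prob_space M" "prob_space E"
  shows "distr (M \<Otimes>\<^sub>M E) E snd = E"
proof (rule measure_eqI)
  interpret M: prob_space M by fact
  interpret E: prob_space E by fact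
  fix A assume "A \<in> sets (distr (M \<Otimes>\<^sub>M E) E snd)"
  then have A: "A \<in> sets E" by simp
  then have "snd -` A \<inter> space (M \<Otimes>\<^sub>M E) = space M \<times> A"
    using sets.sets_into_space by (fastforce simp: space_pair_measure)
  with A show "emeasure (distr (M \<Otimes>\<^sub>M E) E snd) A = emeasure E A"
    by (simp add: emeasure_distr E.emeasure_pair_measure_Times M.emeasure_space_1)
qed simp

lemma indep_var_fst_snd:
  assumes M: "prob_space M" and E: "prob_space E"
    and f: "f \<in> measurable M S" and g: "g \<in> measurable E T"
  shows "prob_space.indep_var (M \<Otimes>\<^sub>M E) S (\<lambda>z. f (fst z)) T (\<lambda>z. g (snd z))"
proof -
  interpret M: prob_space M by fact
  interpret E: prob_space E by fact
  interpret ME: pair_prob_space M E ..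
  interpret G: prob_space "distr E T g" by (rule E.prob_space_distr[OF g])
  have "distr (M \<Otimes>\<^sub>M E) S (\<lambda>z. f (fst z)) = distr (distr (M \<Otimes>\<^sub>M E) M fst) S f"
    by (subst distr_distr[OF f]) (auto simp: comp_def)
  then have 1: "distr (M \<Otimes>\<^sub>M E) S (\<lambda>z. f (fst z)) = distr M S f"
    by (simp add: E.distr_pair_fst)
  have "distr (M \<Otimes>\<^sub>M E) T (\<lambda>z. g (snd z)) = distr (distr (M \<Otimes>\<^sub>M E) E snd) T g"
    by (subst distr_distr[OF g]) (auto simp: comp_def)
  then have 2: "distr (M \<Otimes>\<^sub>M E) T (\<lambda>z. g (snd z)) = distr E T g"
    by (simp add: distr_pair_snd_prob_space[OF M E])
  have "distr M S f \<Otimes>\<^sub>M distr E T g = distr (M \<Otimes>\<^sub>M E) (S \<Otimes>\<^sub>M T) (\<lambda>(x, y). (f x, g y))"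
    by (rule pair_measure_distr[OF f g]) unfold_locales
  then show ?thesis
    unfolding ME.indep_var_distribution_eq 1 2 using f g
    by (auto simp: case_prod_unfold)
qed

lemma levy_subordinator_paths:
  assumes "levy_subordinator M f D"
  shows "\<And>t. 0 \<le> t \<Longrightarrow> D t \<in> borel_measurable M"
    and "AE \<omega> in M. \<forall>t\<ge>0. 0 \<le> D t \<omega>"
    and "AE \<omega> in M. \<forall>t\<ge>0. continuous (at_right t) (\<lambda>s. D s \<omega>)"
    and "\<And>t s. 0 \<le> t \<Longrightarrow> 0 < s \<Longrightarrow> (\<integral>\<omega>. exp (- s * D t \<omega>) \<partial>M) = exp (- t * f s)"
proof -
  have D: "increasing_cadlag_process M D"
    and L: "\<forall>t\<ge>0. \<forall>s>0. (\<integral>\<omega>. exp (- s * D t \<omega>) \<partial>M) = exp (- t * f s)"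
    using assms by (auto simp: levy_subordinator_def)
  show "\<And>t. 0 \<le> t \<Longrightarrow> D t \<in> borel_measurable M"
    using D by (simp add: increasing_cadlag_process_def)
  show "\<And>t s. 0 \<le> t \<Longrightarrow> 0 < s \<Longrightarrow> (\<integral>\<omega>. exp (- s * D t \<omega>) \<partial>M) = exp (- t * f s)"
    using L by blast
  have AE: "AE \<omega> in M. D 0 \<omega> = 0 \<and> mono_on {0..} (\<lambda>t. D t \<omega>) \<and>
      (\<forall>t\<ge>0. continuous (at_right t) (\<lambda>s. D s \<omega>))"
    using D by (simp add: increasing_cadlag_process_def)
  then show "AE \<omega> in M. \<forall>t\<ge>0. continuous (at_right t) (\<lambda>s. D s \<omega>)"
    by eventually_elim blast
  from AE show "AE \<omega> in M. \<forall>t\<ge>0. 0 \<le> D t \<omega>"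
  proof eventually_elim
    case (elim \<omega>)
    then show ?case using mono_onD[of "{0..}" "\<lambda>t. D t \<omega>" 0] by auto
  qed
qed

text \<open>Tilting by exp (- c x) turns the density with rate \<eta> into \<eta> / (\<eta> + c)
  times the density with rate \<eta> + c, which has mass one.\<close>

lemma laplace_exponential_density:
  assumes \<eta>: "0 < \<eta>" and c: "0 \<le> c"
  shows "(\<integral>x. exp (- c * x) \<partial>density lborel (\<lambda>x. ennreal (exponential_density \<eta> x))) = \<eta> / (\<eta> + c)"
proof -
  have pos: "0 < \<eta> + c" using assms by simp
  interpret prob_space "density lborel (\<lambda>x. ennreal (exponential_density (\<eta> + c) x))"
    by (rule prob_space_exponential_density[OF pos])
  have one: "(\<integral>x. exponential_density (\<eta> + c) x \<partial>lborel) = 1"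
    using prob_space pos
      integral_density[of "\<lambda>_. 1 :: real" lborel "exponential_density (\<eta> + c)"]
    by (auto simp: exponential_density_nonneg)
  have "(\<integral>x. exp (- c * x) \<partial>density lborel (\<lambda>x. ennreal (exponential_density \<eta> x)))
      = (\<integral>x. exponential_density \<eta> x * exp (- c * x) \<partial>lborel)"
    using \<eta> by (subst integral_density) (auto simp: exponential_density_nonneg)
  also have "\<dots> = (\<integral>x. \<eta> / (\<eta> + c) * exponential_density (\<eta> + c) x \<partial>lborel)"
  proof (rule Bochner_Integration.integral_cong[OF refl])
    fix x
    have "exp (- x * \<eta>) * exp (- c * x) = exp (- x * (\<eta> + c))"
      by (simp add: algebra_simps flip: exp_add)
    then show "exponential_density \<eta> x * exp (- c * x) = \<eta> / (\<eta> + c) * exponential_density (\<eta> + c) x"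
      using pos by (simp add: exponential_density_def mult.assoc)
  qed
  also have "\<dots> = \<eta> / (\<eta> + c)" using one by simp
  finally show ?thesis .
qed

lemma AE_exponential_density_nonneg:
  "AE x in density lborel (\<lambda>x. ennreal (exponential_density \<eta> x)). 0 \<le> x"
  by (subst AE_density) (auto simp: exponential_density_def)

text \<open>This covers the range s powr \<beta> <= \<eta>, which the series does not reach.
  \<open>D\<close> at an exponential time serves as a probabilistic witness: its transform is known
  for every s > 0, and X has the same law.\<close>

lemma mittag_leffler_laplace:
  assumes M: "prob_space M" and D: "stable_subordinator M \<beta> D"
    and \<beta>: "0 < \<beta>" and \<eta>: "0 < \<eta>" and X: "distributed M lborel X (\<lambda>x. ennreal (mittag_leffler_density \<beta> \<eta> x))"
  shows "AE \<omega> in M. 0 \<le> X \<omega>"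
    and "0 < s \<Longrightarrow> (\<integral>\<omega>. exp (- s * X \<omega>) \<partial>M) = \<eta> / (\<eta> + s powr \<beta>)"
proof -
  interpret M: prob_space M by fact
  \<comment> \<open>\<open>V\<close> below is \<open>D\<close> run up to an independent exponential time living on \<open>E\<close>.\<close>
  define E where "E = density lborel (\<lambda>x. ennreal (exponential_density \<eta> x))"
  have E: "prob_space E"
    unfolding E_def by (rule prob_space_exponential_density[OF \<eta>])
  interpret E: prob_space E by fact
  interpret ME: pair_prob_space M E ..
  have sets_E: "sets E = sets borel" by (simp add: E_def)
  have [measurable]: "snd \<in> borel_measurable (M \<Otimes>\<^sub>M E)"
    using measurable_snd[of M E] by (simp add: measurable_cong_sets[OF refl sets_E])
  have D': "levy_subordinator M (\<lambda>s. s powr \<beta>) D"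
    using D by (simp add: stable_subordinator_def)
  note paths = levy_subordinator_paths[OF D']
  have fst_law: "distr (M \<Otimes>\<^sub>M E) M fst = M"
    by (rule E.distr_pair_fst)
  have snd_law: "distr (M \<Otimes>\<^sub>M E) E snd = E"
    by (rule distr_pair_snd_prob_space[OF M E])
  have AE_fst: "AE z in M \<Otimes>\<^sub>M E. Q (fst z)" if "AE \<omega> in M. Q \<omega>" for Q
    by (rule AE_distrD[OF measurable_fst]) (subst fst_law, rule that)
  have AE_snd: "AE z in M \<Otimes>\<^sub>M E. Q (snd z)" if "AE x in E. Q x" for Q
    by (rule AE_distrD[OF measurable_snd]) (subst snd_law, rule that)
  define V where "V = grid_time_change (\<lambda>t z. D t (fst z)) (snd :: 'a \<times> real \<Rightarrow> real)"
  have snd_nonneg: "AE z in M \<Otimes>\<^sub>M E. 0 \<le> snd z"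
    by (rule AE_snd) (subst E_def, rule AE_exponential_density_nonneg)
  have D_meas: "(\<lambda>z. D t (fst z)) \<in> borel_measurable (M \<Otimes>\<^sub>M E)" if "0 \<le> t" for t
    using paths(1)[OF that] by measurable
  have V_meas: "V \<in> borel_measurable (M \<Otimes>\<^sub>M E)"
    unfolding V_def by (rule measurable_grid_time_change[OF D_meas]) auto
  have V_nonneg: "AE z in M \<Otimes>\<^sub>M E. 0 \<le> V z"
    using snd_nonneg AE_fst[OF paths(2)] AE_fst[OF paths(3)]
    by eventually_elim (auto simp: V_def grid_time_change_eq)
  have V_laplace: "(\<integral>z. exp (- s * V z) \<partial>(M \<Otimes>\<^sub>M E)) = \<eta> / (\<eta> + s powr \<beta>)" if s: "0 < s" for s
  proof -
    have "ME.expectation (\<lambda>z. exp (- s * V z)) = ME.expectation (\<lambda>z. exp (- (s powr \<beta>) * snd z))"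
      unfolding V_def
    proof (rule ME.laplace_grid_time_change[OF D_meas AE_fst[OF paths(2)] AE_fst[OF paths(3)] _ s])
      fix t :: real assume t: "0 \<le> t"
      have "ME.expectation (\<lambda>z. exp (- s * D t (fst z))) = (\<integral>\<omega>. exp (- s * D t \<omega>) \<partial>distr (M \<Otimes>\<^sub>M E) M fst)"
        using paths(1)[OF t] by (subst integral_distr) auto
      then show "ME.expectation (\<lambda>z. exp (- s * D t (fst z))) = exp (- t * s powr \<beta>)"
        using paths(4)[OF t s] by (simp add: E.distr_pair_fst)
      have "ME.indep_var borel (\<lambda>z. D t (fst z)) borel (\<lambda>z. (\<lambda>x. x) (snd z))"
        by (rule indep_var_fst_snd[OF M E paths(1)[OF t]]) (simp add: measurable_cong_sets[OF sets_E refl])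
      then show "ME.indep_var borel (\<lambda>z. D t (fst z)) borel snd" by simp
    qed (use snd_nonneg in auto)
    also have "\<dots> = (\<integral>x. exp (- (s powr \<beta>) * x) \<partial>distr (M \<Otimes>\<^sub>M E) E snd)"
      by (subst integral_distr) (auto simp: measurable_cong_sets[OF sets_E refl])
    also have "\<dots> = \<eta> / (\<eta> + s powr \<beta>)"
      unfolding snd_law unfolding E_def by (rule laplace_exponential_density[OF \<eta>]) simp
    finally show ?thesis .
  qed
  have X_meas [measurable]: "X \<in> borel_measurable M"
    using distributed_measurable[OF X] by simp
  have "distr M borel X = distr M lborel X"
    by (rule distr_cong) auto
  also have "\<dots> = distr (M \<Otimes>\<^sub>M E) borel V"
    unfolding distributed_distr_eq_density[OF X]
    by (rule mittag_leffler_distr_eq[OF ME.prob_space_axioms V_meas V_nonneg \<beta> \<eta> V_laplace])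
  finally have law: "distr M borel X = distr (M \<Otimes>\<^sub>M E) borel V" .
  have "AE x in distr (M \<Otimes>\<^sub>M E) borel V. 0 \<le> x"
    using V_nonneg V_meas by (subst AE_distr_iff) auto
  then show "AE \<omega> in M. 0 \<le> X \<omega>"
    unfolding law[symmetric] by (rule AE_distrD[OF X_meas])
  assume s: "0 < s"
  have "(\<integral>\<omega>. exp (- s * X \<omega>) \<partial>M) = (\<integral>x. exp (- s * x) \<partial>distr M borel X)"
    by (subst integral_distr) auto
  also have "\<dots> = (\<integral>z. exp (- s * V z) \<partial>(M \<Otimes>\<^sub>M E))"
    unfolding law using V_meas by (subst integral_distr) auto
  also note V_laplace[OF s]
  finally show "(\<integral>\<omega>. exp (- s * X \<omega>) \<partial>M) = \<eta> / (\<eta> + s powr \<beta>)" .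
qed

subsection \<open>The subordinated compound processes\<close>

text \<open>The integrand 1 - exp (- x) is dominated by \<open>min x 1\<close> and strictly
  positive, so a zero integral would make \<nu> the null measure, against its infinite mass.
  Positivity at 1 later drives the subordinator to infinity.\<close>

lemma bernstein_fun_pos:
  assumes b: "0 \<le> b" and \<nu>: "infinite_levy_measure \<nu>"
  shows "0 < bernstein_fun b \<nu> 1"
proof -
  have sets: "sets \<nu> = sets (restrict_space borel {0<..})"
    and fin: "(\<integral>\<^sup>+x. ennreal (min x 1) \<partial>\<nu>) < \<infinity>" and inf: "emeasure \<nu> {0<..} = \<infinity>"
    using \<nu> by (auto simp: infinite_levy_measure_def)
  have space: "space \<nu> = {0<..}"
    using sets_eq_imp_space_eq[OF sets] by (simp add: space_restrict_space)
  have meas: "f \<in> borel_measurable \<nu>" if "f \<in> borel_measurable borel" for f :: "real \<Rightarrow> real"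
    unfolding measurable_cong_sets[OF sets refl] using that by (rule measurable_restrict_space1)
  let ?h = "\<lambda>x::real. 1 - exp (- 1 * x)"
  have h_meas: "?h \<in> borel_measurable \<nu>" by (rule meas) measurable
  have h_pos: "0 < ?h x" if "x \<in> space \<nu>" for x using that by (simp add: space)
  have h_int: "integrable \<nu> ?h"
  proof (rule integrableI_bounded[OF h_meas])
    have "(\<integral>\<^sup>+x. ennreal (norm (?h x)) \<partial>\<nu>) \<le> (\<integral>\<^sup>+x. ennreal (min x 1) \<partial>\<nu>)"
    proof (rule nn_integral_mono)
      fix x assume x: "x \<in> space \<nu>"
      have "1 - x \<le> exp (- x)" using exp_ge_add_one_self[of "- x"] by simp
      then show "ennreal (norm (?h x)) \<le> ennreal (min x 1)"
        using h_pos[OF x] by (intro ennreal_leI) auto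
    qed
    with fin show "(\<integral>\<^sup>+x. ennreal (norm (?h x)) \<partial>\<nu>) < \<infinity>" by (rule le_less_trans[rotated])
  qed
  have "0 \<le> (\<integral>x. ?h x \<partial>\<nu>)"
    by (rule Bochner_Integration.integral_nonneg) (use h_pos in \<open>auto intro: less_imp_le\<close>)
  moreover have "(\<integral>x. ?h x \<partial>\<nu>) \<noteq> 0"
  proof
    assume "(\<integral>x. ?h x \<partial>\<nu>) = 0"
    then have "AE x in \<nu>. ?h x = 0"
      using integral_nonneg_eq_0_iff_AE[OF h_int] h_pos by (simp add: AE_I2 less_imp_le)
    then have "AE x in \<nu>. False"
      using AE_space
    proof eventually_elim
      case (elim x)
      with h_pos[of x] show ?case by simp
    qed
    then have "emeasure \<nu> (space \<nu>) = 0"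
      using AE_iff_measurable[of "space \<nu>" \<nu> "\<lambda>_. False"] by simp
    with inf space show False by simp
  qed
  ultimately show ?thesis
    using b by (simp add: bernstein_fun_def)
qed

text \<open>The infimum is meaningful only if the path exceeds t at some time. The Chernoff bound P
  (D n <= t) <= exp t * exp (- n * f 1) tends to 0, so almost every path does so at some integer
  time.\<close>

lemma inverse_subordinator_nonneg:
  assumes M: "prob_space M" and D: "levy_subordinator M f D" and f: "0 < f 1"
  shows "AE \<omega> in M. 0 \<le> inverse_subordinator D t \<omega>"
proof -
  interpret prob_space M by fact
  note paths = levy_subordinator_paths[OF D]
  let ?B = "\<lambda>n. {\<omega> \<in> space M. D (real n) \<omega> \<le> t}"
  have B [measurable]: "?B n \<in> sets M" for n
  proof -
    have [measurable]: "D (real n) \<in> borel_measurable M" by (rule paths(1)) simp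
    show ?thesis by measurable
  qed
  have bound: "prob (?B n) \<le> exp t * exp (- real n * f 1)" for n
  proof -
    have laplace: "expectation (\<lambda>\<omega>. exp (- 1 * D (real n) \<omega>)) = exp (- real n * f 1)"
      by (rule paths(4)) auto
    \<comment> \<open>A Bochner integral is 0 when the integrand is not integrable, whereas this one
      has a positive value.\<close>
    have int: "integrable M (\<lambda>\<omega>. exp (- 1 * D (real n) \<omega>))"
    proof (rule ccontr)
      assume "\<not> integrable M (\<lambda>\<omega>. exp (- 1 * D (real n) \<omega>))"
      then have "expectation (\<lambda>\<omega>. exp (- 1 * D (real n) \<omega>)) = 0"
        by (rule not_integrable_integral_eq)
      with laplace show False by simp
    qed
    have "prob (?B n) = expectation (indicator (?B n))"
      using B by simp
    also have "\<dots> \<le> expectation (\<lambda>\<omega>. exp t * exp (- 1 * D (real n) \<omega>))"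
    proof (rule integral_mono)
      fix \<omega> assume "\<omega> \<in> space M"
      have "1 \<le> exp t * exp (- 1 * D (real n) \<omega>)" if "D (real n) \<omega> \<le> t"
        using that by (simp flip: exp_add)
      then show "indicator (?B n) \<omega> \<le> exp t * exp (- 1 * D (real n) \<omega>)"
        by (auto simp: indicator_def)
    qed (use int B in \<open>auto simp: integrable_indicator_iff emeasure_eq_measure simp del: mult_minus1\<close>)
    also have "\<dots> = exp t * exp (- real n * f 1)"
      by (simp only: integral_mult_right_zero laplace)
    finally show ?thesis .
  qed
  have lim: "(\<lambda>n. exp t * exp (- real n * f 1)) \<longlonglongrightarrow> 0"
  proof -
    have "(\<lambda>n. exp t * exp (- f 1) ^ n) \<longlonglongrightarrow> exp t * 0"
      using f by (intro tendsto_mult tendsto_const LIMSEQ_realpow_zero) auto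
    then show ?thesis by (simp add: mult.commute flip: exp_of_nat_mult)
  qed
  have "prob (\<Inter>n. ?B n) \<le> 0"
  proof (rule LIMSEQ_le_const[OF lim])
    have "prob (\<Inter>n. ?B n) \<le> exp t * exp (- real m * f 1)" for m
      by (rule order_trans[OF finite_measure_mono bound[of m]]) auto
    then show "\<exists>N. \<forall>n\<ge>N. prob (\<Inter>n. ?B n) \<le> exp t * exp (- real n * f 1)" by blast
  qed
  then have "(\<Inter>n. ?B n) \<in> null_sets M"
    using measure_nonneg[of M "\<Inter>n. ?B n"] by (auto simp: null_sets_def emeasure_eq_measure)
  then have "AE \<omega> in M. \<omega> \<notin> (\<Inter>n. ?B n)" by (rule AE_not_in)
  then show ?thesis
    using AE_space
  proof eventually_elim
    case (elim \<omega>)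
    then obtain n :: nat where "t < D (real n) \<omega>" by (auto simp: not_le)
    then have "{r. r \<ge> 0 \<and> D r \<omega> > t} \<noteq> {}" by (auto intro!: exI[of _ "real n"])
    then show ?case
      unfolding inverse_subordinator_def by (rule cInf_greatest) auto
  qed
qed

text \<open>This is \<open>laplace_signed_unique\<close> with constant weight 1. The point n = 0,
  which the hypothesis leaves out, is the total mass.\<close>

lemma (in prob_space) laplace_distr_unique:
  fixes U V :: "'a \<Rightarrow> real"
  assumes [measurable]: "U \<in> borel_measurable M" "V \<in> borel_measurable M"
    and U: "AE \<omega> in M. 0 \<le> U \<omega>" and V: "AE \<omega> in M. 0 \<le> V \<omega>"
    and eq: "\<And>s. 0 < s \<Longrightarrow> expectation (\<lambda>\<omega>. exp (- s * U \<omega>)) = expectation (\<lambda>\<omega>. exp (- s * V \<omega>))"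
  shows "distr M borel U = distr M borel V"
proof (rule measure_eqI)
  fix A assume "A \<in> sets (distr M borel U)"
  then have A [measurable]: "A \<in> sets borel" by simp
  have ind: "expectation (\<lambda>\<omega>. indicator A (Z \<omega>) * 1) = prob (Z -` A \<inter> space M)"
    if [measurable]: "Z \<in> borel_measurable M" for Z
  proof -
    have "expectation (\<lambda>\<omega>. indicator A (Z \<omega>) * 1) = expectation (indicat_real (Z -` A \<inter> space M))"
      by (rule Bochner_Integration.integral_cong) (auto simp: indicator_def)
    then show ?thesis by simp
  qed
  have "expectation (\<lambda>\<omega>. indicat_real A (U \<omega>) * 1) = expectation (\<lambda>\<omega>. indicator A (V \<omega>) * 1)"
  proof (rule laplace_signed_unique[OF _ _ _ _ U V _ A])
    fix n :: nat
    show "expectation (\<lambda>\<omega>. exp (- real n * U \<omega>) * 1) = expectation (\<lambda>\<omega>. exp (- real n * V \<omega>) * 1)"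
      using eq[of "real n"] by (cases "n = 0") auto
  qed auto
  then have "prob (U -` A \<inter> space M) = prob (V -` A \<inter> space M)"
    by (simp only: ind assms)
  then show "emeasure (distr M borel U) A = emeasure (distr M borel V) A"
    by (simp add: emeasure_distr emeasure_eq_measure)
qed simp

section \<open>Laws up to null events\<close>

lemma borel_measurable_completion_AE:
  fixes f g :: "'a \<Rightarrow> real"
  assumes f: "f \<in> borel_measurable M" and ae: "AE x in M. g x = f x"
  shows "g \<in> borel_measurable (completion M)"
proof (rule measurableI)
  fix A :: "real set" assume A: "A \<in> sets borel"
  have "AE x in completion M. x \<in> f -` A \<inter> space M \<longleftrightarrow> x \<in> g -` A \<inter> space (completion M)"
    using AE_completion[OF ae] by eventually_elim auto
  then show "g -` A \<inter> space (completion M) \<in> sets (completion M)"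
    by (rule completion.in_sets_AE) (use measurable_sets[OF f A] in auto)
qed simp

text \<open>U and V may be measurable only for the completion; they are replaced by versions
  measurable on M, whose laws can be compared there.\<close>

lemma eq_in_distribution_AE:
  assumes f: "f \<in> borel_measurable M" "AE x in M. U x = f x"
    and g: "g \<in> borel_measurable M" "AE x in M. V x = g x"
    and fg: "distr M borel f = distr M borel g"
  shows "eq_in_distribution M U V"
proof -
  note U = borel_measurable_completion_AE[OF f] and V = borel_measurable_completion_AE[OF g]
  have "distr (completion M) borel U = distr (completion M) borel f"
    by (rule distr_cong_AE) (use f U in \<open>auto intro: AE_completion measurable_completion\<close>)
  moreover have "distr (completion M) borel V = distr (completion M) borel g"
    by (rule distr_cong_AE) (use g V in \<open>auto intro: AE_completion measurable_completion\<close>)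
  ultimately show ?thesis
    using U V fg f(1) g(1) by (simp add: eq_in_distribution_def distr_completion)
qed

section \<open>Paths, exponential jumps and the stopped count\<close>

lemma measurable_path_eval: "0 \<le> t \<Longrightarrow> (\<lambda>p. p t) \<in> borel_measurable path_space"
  unfolding path_space_def by (rule measurable_component_singleton) simp

lemma path_eval [simp]: "0 \<le> t \<Longrightarrow> path X \<omega> t = X t \<omega>"
  by (simp add: path_def)

lemma distributed_exponential_laplace:
  assumes M: "prob_space M" and \<eta>: "0 < \<eta>" and X: "distributed M lborel X (\<lambda>x. ennreal (exponential_density \<eta> x))"
  shows "AE \<omega> in M. 0 \<le> X \<omega>"
    and "0 \<le> c \<Longrightarrow> (\<integral>\<omega>. exp (- c * X \<omega>) \<partial>M) = \<eta> / (\<eta> + c)"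
proof -
  have X_meas: "X \<in> measurable M lborel"
    using distributed_measurable[OF X] .
  show "AE \<omega> in M. 0 \<le> X \<omega>"
    by (rule AE_distrD[OF X_meas])
      (subst distributed_distr_eq_density[OF X], rule AE_exponential_density_nonneg)
  assume c: "0 \<le> c"
  have "(\<integral>\<omega>. exp (- c * X \<omega>) \<partial>M) = (\<integral>x. exp (- c * x) \<partial>distr M lborel X)"
    using X_meas by (subst integral_distr) auto
  then show "(\<integral>\<omega>. exp (- c * X \<omega>) \<partial>M) = \<eta> / (\<eta> + c)"
    unfolding distributed_distr_eq_density[OF X] laplace_exponential_density[OF \<eta> c] .
qed

text \<open>Provides a measurable version of N at time E t that is a measurable function \<kappa> of
  the two paths alone, the form in which independence from the jumps can be applied. The limit along
  the grid is real-valued; \<open>nat\<close> and the floor recover the integer wherever the path is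
  right-continuous.\<close>

lemma stopped_process_modification:
  assumes M: "prob_space M" and t: "0 \<le> t" and N: "poisson_process M l N"
    and NE: "processes_independent M (\<lambda>t \<omega>. real (N t \<omega>)) E"
    and E_nonneg: "AE \<omega> in M. 0 \<le> E t \<omega>"
  obtains \<kappa> K where "\<kappa> \<in> measurable (path_space \<Otimes>\<^sub>M path_space) (count_space UNIV)"
    and "K = (\<lambda>\<omega>. \<kappa> (path (\<lambda>t \<omega>. real (N t \<omega>)) \<omega>, path E \<omega>))"
    and "K \<in> measurable M (count_space UNIV)"
    and "AE \<omega> in M. K \<omega> = time_change N E t \<omega>"
proof -
  define G where "G = grid_time_change (\<lambda>r q. fst q r) (\<lambda>q::(real \<Rightarrow> real) \<times> (real \<Rightarrow> real). snd q t)"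
  define \<kappa> where "\<kappa> q = nat \<lfloor>G q\<rfloor>" for q
  define K where "K \<omega> = \<kappa> (path (\<lambda>t \<omega>. real (N t \<omega>)) \<omega>, path E \<omega>)" for \<omega>
  note eval = measurable_path_eval
  have [measurable]: "G \<in> borel_measurable (path_space \<Otimes>\<^sub>M path_space)"
    unfolding G_def
    by (rule measurable_grid_time_change)
      (rule measurable_compose[OF measurable_fst eval] measurable_compose[OF measurable_snd eval[OF t]], assumption?)+
  have \<kappa>: "\<kappa> \<in> measurable (path_space \<Otimes>\<^sub>M path_space) (count_space UNIV)"
    unfolding \<kappa>_def by measurable
  have "(\<lambda>\<omega>. (path (\<lambda>t \<omega>. real (N t \<omega>)) \<omega>, path E \<omega>)) \<in> measurable M (path_space \<Otimes>\<^sub>M path_space)"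
    using NE by (intro measurable_Pair) (auto simp: processes_independent_def independent_elements_def)
  then have K: "K \<in> measurable M (count_space UNIV)"
    unfolding K_def by (rule measurable_compose[OF _ \<kappa>])
  \<comment> \<open>\<open>path\<close> keeps only times t >= 0, and every grid time is nonnegative,
    so nothing is lost by evaluating the restricted path.\<close>
  have G_eq: "G (path (\<lambda>t \<omega>. real (N t \<omega>)) \<omega>, path E \<omega>)
      = grid_time_change (\<lambda>t \<omega>. real (N t \<omega>)) (E t) \<omega>" for \<omega>
    using t by (simp add: G_def grid_time_change_def grid_above_nonneg)
  have "AE \<omega> in M. \<forall>t\<ge>0. continuous (at_right t) (\<lambda>s. real (N s \<omega>))"
    using N by (auto simp: poisson_process_def increasing_cadlag_process_def elim: eventually_mono)
  with E_nonneg have "AE \<omega> in M. K \<omega> = time_change N E t \<omega>"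
  proof eventually_elim
    case (elim \<omega>)
    then have "grid_time_change (\<lambda>t \<omega>. real (N t \<omega>)) (E t) \<omega> = real (N (E t \<omega>) \<omega>)"
      by (intro grid_time_change_eq) auto
    then show ?case
      by (simp add: K_def \<kappa>_def G_eq time_change_def)
  qed
  with \<kappa> K show thesis
    using that[of \<kappa> K] by (simp add: K_def fun_eq_iff)
qed

text \<open>The partial sum is a function of the jump sequence and K factors through the two paths,
  so independence of these random elements carries over.\<close>

lemma indep_var_jumps_count:
  assumes M: "prob_space M" and ind: "jumps_independent_of M X N E"
    and \<kappa>: "\<kappa> \<in> measurable (path_space \<Otimes>\<^sub>M path_space) (count_space UNIV)"
    and K: "K = (\<lambda>\<omega>. \<kappa> (path (\<lambda>t \<omega>. real (N t \<omega>)) \<omega>, path E \<omega>))"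
  shows "prob_space.indep_var M borel (\<lambda>\<omega>. \<Sum>i=1..n. X i \<omega>) borel (\<lambda>\<omega>. indicator {n} (K \<omega>) :: real)"
proof -
  interpret prob_space M by fact
  have f: "(\<lambda>x. \<Sum>i=1..n. x i) \<in> borel_measurable (PiM {1..} (\<lambda>_. borel :: real measure))"
    by (rule borel_measurable_sum) (auto intro!: measurable_component_singleton)
  have g: "(\<lambda>q. indicator {n} (\<kappa> q) :: real) \<in> borel_measurable (path_space \<Otimes>\<^sub>M path_space)"
    by (rule measurable_compose[OF \<kappa>]) simp
  show ?thesis
    using independent_elements_compose[OF ind[unfolded jumps_independent_of_def] f g]
    by (simp add: K)
qed

theorem theorem4p2:
  fixes M :: "'a measure"
    and b l \<beta> \<eta> :: real
    and \<nu> :: "real measure"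
    and D\<^sub>f D\<^sub>\<beta> E\<^sub>f :: "real \<Rightarrow> 'a \<Rightarrow> real"
    and N N\<^sub>f :: "real \<Rightarrow> 'a \<Rightarrow> nat"
    and X X' :: "nat \<Rightarrow> 'a \<Rightarrow> real"
    and Y Y' :: "real \<Rightarrow> 'a \<Rightarrow> real"
  assumes "prob_space M"
    and "b \<ge> 0" and "infinite_levy_measure \<nu>"
    and "levy_subordinator M (bernstein_fun b \<nu>) D\<^sub>f"
    and E_f: "E\<^sub>f = inverse_subordinator D\<^sub>f"
    and "l > 0" and "poisson_process M l N"
    and "processes_independent M (\<lambda>t \<omega>. real (N t \<omega>)) E\<^sub>f"
    and N_f: "N\<^sub>f = time_change N E\<^sub>f"
    and "0 < \<beta>" and "\<beta> < 1" and "\<eta> > 0"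
    and "iid_jumps M (mittag_leffler_density \<beta> \<eta>) X"
    and "jumps_independent_of M X N E\<^sub>f"
    and "iid_jumps M (exponential_density \<eta>) X'"
    and "jumps_independent_of M X' N E\<^sub>f"
    and Y: "Y = compound_process N\<^sub>f X"
    and Y': "Y' = compound_process N\<^sub>f X'"
    and "stable_subordinator M \<beta> D\<^sub>\<beta>"
    and "processes_independent M D\<^sub>\<beta> Y'"
  shows "\<forall>t\<ge>0. eq_in_distribution M (Y t) (time_change D\<^sub>\<beta> Y' t)"
proof (intro allI impI)
  fix t :: real assume t: "0 \<le> t"
  interpret prob_space M by fact
  note \<beta> = \<open>0 < \<beta>\<close> and \<eta> = \<open>\<eta> > 0\<close>
  have "AE \<omega> in M. 0 \<le> E\<^sub>f t \<omega>"
    unfolding E_f using bernstein_fun_pos[OF \<open>b \<ge> 0\<close> \<open>infinite_levy_measure \<nu>\<close>]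
    by (intro inverse_subordinator_nonneg[OF \<open>prob_space M\<close> \<open>levy_subordinator M (bernstein_fun b \<nu>) D\<^sub>f\<close>])
  then obtain \<kappa> K
    where \<kappa>: "\<kappa> \<in> measurable (path_space \<Otimes>\<^sub>M path_space) (count_space UNIV)"
      and K_eq: "K = (\<lambda>\<omega>. \<kappa> (path (\<lambda>t \<omega>. real (N t \<omega>)) \<omega>, path E\<^sub>f \<omega>))"
      and K [measurable]: "K \<in> measurable M (count_space UNIV)"
      and K_AE: "AE \<omega> in M. K \<omega> = N\<^sub>f t \<omega>"
    unfolding N_f
    by (rule stopped_process_modification[OF \<open>prob_space M\<close> t \<open>poisson_process M l N\<close>
          \<open>processes_independent M (\<lambda>t \<omega>. real (N t \<omega>)) E\<^sub>f\<close>])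
  have X: "indep_vars (\<lambda>_. borel) X {1..}"
    using \<open>iid_jumps M (mittag_leffler_density \<beta> \<eta>) X\<close> by (simp add: iid_jumps_def)
  have X_dist: "distributed M lborel (X i) (\<lambda>x. ennreal (mittag_leffler_density \<beta> \<eta> x))" if "1 \<le> i" for i
    using \<open>iid_jumps M (mittag_leffler_density \<beta> \<eta>) X\<close> that by (simp add: iid_jumps_def)
  have X': "indep_vars (\<lambda>_. borel) X' {1..}"
    using \<open>iid_jumps M (exponential_density \<eta>) X'\<close> by (simp add: iid_jumps_def)
  have X'_dist: "distributed M lborel (X' i) (\<lambda>x. ennreal (exponential_density \<eta> x))" if "1 \<le> i" for i
    using \<open>iid_jumps M (exponential_density \<eta>) X'\<close> that by (simp add: iid_jumps_def)
  note X_nonneg = mittag_leffler_laplace(1)[OF \<open>prob_space M\<close> \<open>stable_subordinator M \<beta> D\<^sub>\<beta>\<close> \<beta> \<eta> X_dist]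
  note X_laplace = mittag_leffler_laplace(2)[OF \<open>prob_space M\<close> \<open>stable_subordinator M \<beta> D\<^sub>\<beta>\<close> \<beta> \<eta> X_dist]
  note X'_nonneg = distributed_exponential_laplace(1)[OF \<open>prob_space M\<close> \<eta> X'_dist]
  note X'_laplace = distributed_exponential_laplace(2)[OF \<open>prob_space M\<close> \<eta> X'_dist]
  define U where "U \<omega> = (\<Sum>i=1..K \<omega>. X i \<omega>)" for \<omega>
  define V where "V = grid_time_change D\<^sub>\<beta> (Y' t)"
  have U_AE: "AE \<omega> in M. Y t \<omega> = U \<omega>"
    using K_AE by eventually_elim (simp add: Y U_def compound_process_def)
  have Y'_AE: "AE \<omega> in M. Y' t \<omega> = (\<Sum>i=1..K \<omega>. X' i \<omega>)"
    using K_AE by eventually_elim (simp add: Y' compound_process_def)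
  have U_meas: "U \<in> borel_measurable M"
    unfolding U_def
    by (rule measurable_compose_countable[OF _ K])
      (use X in \<open>auto intro!: borel_measurable_sum simp: indep_vars_def\<close>)
  have ind: "independent_elements M path_space (path D\<^sub>\<beta>) path_space (path Y')"
    using \<open>processes_independent M D\<^sub>\<beta> Y'\<close> by (simp add: processes_independent_def)
  have DY: "indep_var borel (D\<^sub>\<beta> r) borel (Y' t)" if "0 \<le> r" for r
    using independent_elements_compose[OF ind measurable_path_eval[OF that] measurable_path_eval[OF t]]
      that t by simp
  \<comment> \<open>Measurability of \<open>Y' t\<close> itself is contained in the independence of
    the paths of \<open>D\<^sub>\<beta>\<close> and \<open>Y'\<close>; for \<open>Y t\<close> the
    version U stands in.\<close>
  have Y'_meas: "Y' t \<in> borel_measurable M"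
    using DY[of 0] by (auto dest: indep_var_rv2)
  have D: "levy_subordinator M (\<lambda>s. s powr \<beta>) D\<^sub>\<beta>"
    using \<open>stable_subordinator M \<beta> D\<^sub>\<beta>\<close> by (simp add: stable_subordinator_def)
  note paths = levy_subordinator_paths[OF D]
  have X_all: "AE \<omega> in M. \<forall>i. 1 \<le> i \<longrightarrow> 0 \<le> X i \<omega>"
    using X_nonneg by (auto simp: AE_all_countable)
  have X'_all: "AE \<omega> in M. \<forall>i. 1 \<le> i \<longrightarrow> 0 \<le> X' i \<omega>"
    using X'_nonneg by (auto simp: AE_all_countable)
  have U_nonneg: "AE \<omega> in M. 0 \<le> U \<omega>"
    using X_all by eventually_elim (auto simp: U_def intro!: sum_nonneg)
  have Y'_nonneg: "AE \<omega> in M. 0 \<le> Y' t \<omega>"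
    using X'_all Y'_AE by eventually_elim (auto intro!: sum_nonneg)
  have V_meas: "V \<in> borel_measurable M"
    unfolding V_def by (rule measurable_grid_time_change[OF paths(1) Y'_meas])
  have V_AE: "AE \<omega> in M. time_change D\<^sub>\<beta> Y' t \<omega> = V \<omega>"
    using Y'_nonneg paths(3) by eventually_elim (simp add: V_def time_change_def grid_time_change_eq)
  have V_nonneg: "AE \<omega> in M. 0 \<le> V \<omega>"
    using V_AE Y'_nonneg paths(2) by eventually_elim (metis time_change_def)
  have "distr M borel U = distr M borel V"
  proof (rule laplace_distr_unique[OF U_meas V_meas U_nonneg V_nonneg])
    fix s :: real assume s: "0 < s"
    have "expectation (\<lambda>\<omega>. exp (- s * U \<omega>)) = expectation (\<lambda>\<omega>. (\<eta> / (\<eta> + s powr \<beta>)) ^ K \<omega>)"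
      unfolding U_def
      by (rule laplace_compound[OF K X X_nonneg X_laplace s
            indep_var_jumps_count[OF \<open>prob_space M\<close> \<open>jumps_independent_of M X N E\<^sub>f\<close> \<kappa> K_eq]]) (use s in auto)
    \<comment> \<open>\<open>laplace_compound\<close> read backwards: the number \<eta> / (\<eta> +
      s powr \<beta>) is also the transform of an exponential jump, taken at s powr \<beta> instead
      of s.\<close>
    also have "\<dots> = expectation (\<lambda>\<omega>. exp (- (s powr \<beta>) * (\<Sum>i=1..K \<omega>. X' i \<omega>)))"
      by (rule laplace_compound[OF K X' X'_nonneg X'_laplace _
            indep_var_jumps_count[OF \<open>prob_space M\<close> \<open>jumps_independent_of M X' N E\<^sub>f\<close> \<kappa> K_eq], symmetric])
        (use s in auto)
    also have "\<dots> = expectation (\<lambda>\<omega>. exp (- (s powr \<beta>) * Y' t \<omega>))"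
    proof (rule integral_cong_AE)
      show "(\<lambda>\<omega>. exp (- (s powr \<beta>) * Y' t \<omega>)) \<in> borel_measurable M"
        using Y'_meas by measurable
      have "(\<lambda>\<omega>. \<Sum>i=1..K \<omega>. X' i \<omega>) \<in> borel_measurable M"
        by (rule measurable_compose_countable[OF _ K])
          (use X' in \<open>auto intro!: borel_measurable_sum simp: indep_vars_def\<close>)
      then show "(\<lambda>\<omega>. exp (- (s powr \<beta>) * (\<Sum>i=1..K \<omega>. X' i \<omega>))) \<in> borel_measurable M"
        by measurable
      show "AE \<omega> in M. exp (- (s powr \<beta>) * (\<Sum>i=1..K \<omega>. X' i \<omega>)) = exp (- (s powr \<beta>) * Y' t \<omega>)"
        using Y'_AE by eventually_elim simp
    qed
    \<comment> \<open>The same argument s powr \<beta> is the Laplace exponent of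
      \<open>D\<^sub>\<beta>\<close> at s, so the expression is the transform at s of the
      subordinator run up to time \<open>Y' t\<close>.\<close>
    also have "\<dots> = expectation (\<lambda>\<omega>. exp (- s * V \<omega>))"
      unfolding V_def
      by (rule laplace_grid_time_change[OF paths(1) paths(2) paths(3) paths(4) s _ Y'_meas Y'_nonneg DY, symmetric])
        (use s in auto)
    finally show "expectation (\<lambda>\<omega>. exp (- s * U \<omega>)) = expectation (\<lambda>\<omega>. exp (- s * V \<omega>))" .
  qed
  then show "eq_in_distribution M (Y t) (time_change D\<^sub>\<beta> Y' t)"
    by (rule eq_in_distribution_AE[OF U_meas U_AE V_meas V_AE])
qed

end
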